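(* Let $\vec{\mathbb{A}}_n$ be the linearly oriented quiver $n\to n-1\to\cdots\to 2\to 1$. (1) For every $n\ge1$ the Euler form on $\operatorname{rep}(\vec{\mathbb{A}}_n,\mathbb{F}_1)$ is well-defined: for all $L,N\in\operatorname{rep}(\vec{\mathbb{A}}_n,\mathbb{F}_1)$ the pointed set $\operatorname{Ext}^i(L,N)$ is finite for every $i\ge0$, and the sum $\langle L,N\rangle=\sum_{i=0}^\infty(-1)^i\dim\operatorname{Ext}^i(L,N)$ has only finitely many nonzero terms. (2) For $n=2$ the Euler form does not descend to the Grothendieck group of $\operatorname{rep}(\vec{\mathbb{A}}_2,\mathbb{F}_1)$: there exist representations $L,L',N,N'$ of $\vec{\mathbb{A}}_2$ over $\mathbb{F}_1$ with $\underline{\dim}\,L=\underline{\dim}\,L'$ and $\underline{\dim}\,N=\underline{\dim}\,N'$ but $\langle L,N\rangle\ne\langle L',N'\rangle$.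
   Context: A finite-dimensional $\mathbb{F}_1$-vector space is a finite pointed set $V=(V,0_V)$, of dimension $\dim V=|V|-1$; in particular a finite pointed set $X$ has $\dim X=|X|-1$. An $\mathbb{F}_1$-linear map $f:V\to W$ is a pointed function whose restriction to $V\setminus f^{-1}(0_W)$ is injective. $\vec{\mathbb{A}}_n$ has vertices $1,\dots,n$ and arrows $\alpha_i:i+1\to i$ for $1\le i\le n-1$. A representation $M=(M_i,M_\alpha)$ assigns a finite-dimensional $\mathbb{F}_1$-vector space $M_i$ to each vertex $i$ and an $\mathbb{F}_1$-linear map $M_\alpha:M_{s(\alpha)}\to M_{t(\alpha)}$ to each arrow $\alpha$. Its dimension vector is $\underline{\dim}\,M=(\dim M_i)_i$. A morphism $\Phi=(\phi_i):M\to N$ is a family of $\mathbb{F}_1$-linear maps $\phi_i:M_i\to N_i$ with $\phi_{t(\alpha)}M_\alpha=N_\alpha\phi_{s(\alpha)}$ for all arrows $\alpha$. This gives the category $\operatorname{rep}(\vec{\mathbb{A}}_n,\mathbb{F}_1)$, with zero object $\mathbf{0}$ (all spaces are $\{0\}$). Direct sums are vertexwise wedge sums of pointed sets. The kernel $\ker\Phi$ is vertexwise $\phi_i^{-1}(0)$ and the image is vertexwise $\phi_i(M_i)$; $\Phi$ is a monomorphism iff $\ker\Phi=\mathbf{0}$ and an epimorphism iff $\operatorname{im}\Phi=N$. For $m\ge1$, an $m$-extension of $N$ by $L$ is an exact sequence (of length $m+2$) $L\rightarrowtail E_m\to\cdots\to E_1\twoheadrightarrow N$: the first map is a monomorphism,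 the last an epimorphism, and at each middle term the kernel of the outgoing map equals the image of the incoming map. Write $\epsilon\leadsto\epsilon'$ if there are morphisms $E_i\to E'_i$ between the middle terms which, together with the identities of $L$ and $N$, form a commutative diagram. $\operatorname{Ext}^m(N,L)$ is the set of $m$-extensions modulo the equivalence relation generated by $\leadsto$. It is a pointed set with base point $0$ the class of $L\rightarrowtail L\oplus N\twoheadrightarrow N$ (canonical inclusion and projection) if $m=1$, and of $L\xrightarrow{=}L\to\mathbf{0}\to\cdots\to\mathbf{0}\to N\xrightarrow{=}N$ if $m\ge2$. By convention $\operatorname{Ext}^0(N,L)=\operatorname{Hom}(N,L)$, pointed by the zero morphism. The Grothendieck group of $\operatorname{rep}(\vec{\mathbb{A}}_2,\mathbb{F}_1)$ is identified with $\mathbb{Z}^2$ via $M\mapsto\underline{\dim}\,M$. *)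

theory Defs
  imports
    "HOL-Library.FuncSet"
    "HOL-Library.Groups_Big_Fun"
    "HOL-Library.Infinite_Typeclass"
begin

subsection \<open>Vector spaces over the field with one element\<close>

record 'a pointed =
  points :: "'a set"
  base :: 'a

definition f1_space :: "'a pointed \<Rightarrow> bool" where
  "f1_space V \<longleftrightarrow> finite (points V) \<and> base V \<in> points V"

definition pdim :: "'a pointed \<Rightarrow> nat" where
  "pdim V = card (points V) - 1"

text \<open>All maps are taken extensional (\<^const>\<open>undefined\<close> outside the source), so that
  equality of maps is equality of HOL functions and sets of maps have the right cardinality.\<close>

definition f1_linear :: "'a pointed \<Rightarrow> 'a pointed \<Rightarrow> ('a \<Rightarrow> 'a) set" where
  "f1_linear V W =
     {f \<in> points V \<rightarrow>\<^sub>E points W. f (base V) = base W \<and> inj_on f {x \<in> points V. f x \<noteq> base W}}"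

subsection \<open>Representations of the linear quiver with vertices 1, ..., n\<close>

text \<open>\<open>arr M i\<close> is the map at the arrow from \<open>i + 1\<close> to \<open>i\<close>, for \<open>1 \<le> i \<le> n - 1\<close>.\<close>

record 'a rep =
  vert :: "nat \<Rightarrow> 'a pointed"
  arr :: "nat \<Rightarrow> 'a \<Rightarrow> 'a"

type_synonym 'a mor = "nat \<Rightarrow> 'a \<Rightarrow> 'a"

definition reps :: "nat \<Rightarrow> 'a rep set" where
  "reps n = {M. vert M \<in> {1..n} \<rightarrow>\<^sub>E {V. f1_space V} \<and>
                arr M \<in> (\<Pi>\<^sub>E i\<in>{1..<n}. f1_linear (vert M (i + 1)) (vert M i))}"

definition dimvec :: "nat \<Rightarrow> 'a rep \<Rightarrow> nat \<Rightarrow> nat" where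
  "dimvec n M = (\<lambda>i\<in>{1..n}. pdim (vert M i))"

definition Hom :: "nat \<Rightarrow> 'a rep \<Rightarrow> 'a rep \<Rightarrow> 'a mor set" where
  "Hom n M N = {\<phi> \<in> (\<Pi>\<^sub>E i\<in>{1..n}. f1_linear (vert M i) (vert N i)).
     \<forall>i\<in>{1..<n}. \<forall>x\<in>points (vert M (i + 1)). \<phi> i (arr M i x) = arr N i (\<phi> (i + 1) x)}"

definition id_mor :: "nat \<Rightarrow> 'a rep \<Rightarrow> 'a mor" where
  "id_mor n M = (\<lambda>i\<in>{1..n}. \<lambda>x\<in>points (vert M i). x)"

definition zero_mor :: "nat \<Rightarrow> 'a rep \<Rightarrow> 'a rep \<Rightarrow> 'a mor" where
  "zero_mor n M N = (\<lambda>i\<in>{1..n}. \<lambda>x\<in>points (vert M i). base (vert N i))"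

text \<open>\<open>comp_mor n M \<psi> \<phi>\<close> is \<open>\<psi> \<circ> \<phi>\<close>, where \<open>M\<close> is the source of \<open>\<phi>\<close>.\<close>

definition comp_mor :: "nat \<Rightarrow> 'a rep \<Rightarrow> 'a mor \<Rightarrow> 'a mor \<Rightarrow> 'a mor" where
  "comp_mor n M \<psi> \<phi> = (\<lambda>i\<in>{1..n}. compose (points (vert M i)) (\<psi> i) (\<phi> i))"

text \<open>Kernels and images are given by their families of underlying sets.\<close>

definition ker :: "nat \<Rightarrow> 'a rep \<Rightarrow> 'a rep \<Rightarrow> 'a mor \<Rightarrow> nat \<Rightarrow> 'a set" where
  "ker n M N \<phi> = (\<lambda>i\<in>{1..n}. {x \<in> points (vert M i). \<phi> i x = base (vert N i)})"

definition im :: "nat \<Rightarrow> 'a rep \<Rightarrow> 'a mor \<Rightarrow> nat \<Rightarrow> 'a set" where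
  "im n M \<phi> = (\<lambda>i\<in>{1..n}. \<phi> i ` points (vert M i))"

definition is_mono :: "nat \<Rightarrow> 'a rep \<Rightarrow> 'a rep \<Rightarrow> 'a mor \<Rightarrow> bool" where
  "is_mono n M N \<phi> \<longleftrightarrow> ker n M N \<phi> = (\<lambda>i\<in>{1..n}. {base (vert M i)})"

definition is_epi :: "nat \<Rightarrow> 'a rep \<Rightarrow> 'a rep \<Rightarrow> 'a mor \<Rightarrow> bool" where
  "is_epi n M N \<phi> \<longleftrightarrow> im n M \<phi> = (\<lambda>i\<in>{1..n}. points (vert N i))"

definition zero_rep :: "nat \<Rightarrow> 'a rep" where
  "zero_rep n = \<lparr>vert = (\<lambda>i\<in>{1..n}. \<lparr>points = {undefined}, base = undefined\<rparr>),
                 arr = (\<lambda>i\<in>{1..<n}. \<lambda>x\<in>{undefined}. undefined)\<rparr>"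

subsection \<open>Direct sums\<close>

text \<open>Spaces live inside one infinite type, so that every finite pointed set is isomorphic to
  one of them. Disjoint unions are formed inside that type along a fixed injection
  \<^typ>\<open>'a + 'a \<Rightarrow> 'a\<close>, which exists because the type is infinite. In a wedge the base point
  is represented by that of the left summand.\<close>

definition sum_emb :: "'a::infinite + 'a \<Rightarrow> 'a" where
  "sum_emb = (SOME f. inj f)"

definition wedge_inl :: "'a::infinite \<Rightarrow> 'a" where
  "wedge_inl x = sum_emb (Inl x)"

definition wedge_inr :: "'a::infinite pointed \<Rightarrow> 'a pointed \<Rightarrow> 'a \<Rightarrow> 'a" where
  "wedge_inr V W y = (if y = base W then sum_emb (Inl (base V)) else sum_emb (Inr y))"

definition wedge :: "'a::infinite pointed \<Rightarrow> 'a pointed \<Rightarrow> 'a pointed" where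
  "wedge V W = \<lparr>points = wedge_inl ` points V \<union> wedge_inr V W ` points W,
                base = wedge_inl (base V)\<rparr>"

definition dsum :: "nat \<Rightarrow> 'a::infinite rep \<Rightarrow> 'a rep \<Rightarrow> 'a rep" where
  "dsum n L N = \<lparr>
     vert = (\<lambda>i\<in>{1..n}. wedge (vert L i) (vert N i)),
     arr = (\<lambda>i\<in>{1..<n}. \<lambda>z\<in>points (wedge (vert L (i + 1)) (vert N (i + 1))).
       case inv sum_emb z of
         Inl x \<Rightarrow> wedge_inl (arr L i x)
       | Inr y \<Rightarrow> wedge_inr (vert L i) (vert N i) (arr N i y))\<rparr>"

definition dsum_incl :: "nat \<Rightarrow> 'a::infinite rep \<Rightarrow> 'a mor" where
  "dsum_incl n L = (\<lambda>i\<in>{1..n}. \<lambda>x\<in>points (vert L i). wedge_inl x)"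

definition dsum_proj :: "nat \<Rightarrow> 'a::infinite rep \<Rightarrow> 'a rep \<Rightarrow> 'a mor" where
  "dsum_proj n L N = (\<lambda>i\<in>{1..n}. \<lambda>z\<in>points (wedge (vert L i) (vert N i)).
     case inv sum_emb z of Inl x \<Rightarrow> base (vert N i) | Inr y \<Rightarrow> y)"

subsection \<open>Extensions\<close>

text \<open>The sequence from \<open>L\<close> through \<open>E\<^sub>m, \<dots>, E\<^sub>1\<close> to \<open>N\<close> is encoded by the list
  \<open>[E\<^sub>m, \<dots>, E\<^sub>1]\<close> of middle terms and the list of its \<open>m + 1\<close> maps, both read from left to right.\<close>

type_synonym 'a ext = "'a rep list \<times> 'a mor list"

definition terms :: "'a rep \<Rightarrow> 'a rep \<Rightarrow> 'a ext \<Rightarrow> 'a rep list" where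
  "terms N L e = L # fst e @ [N]"

definition maps :: "'a ext \<Rightarrow> 'a mor list" where
  "maps e = snd e"

definition extensions :: "nat \<Rightarrow> nat \<Rightarrow> 'a rep \<Rightarrow> 'a rep \<Rightarrow> 'a ext set" where
  "extensions n m N L = {e.
     length (fst e) = m \<and> set (fst e) \<subseteq> reps n \<and> length (maps e) = m + 1 \<and>
     (let X = (\<lambda>k. terms N L e ! k); f = (\<lambda>k. maps e ! k) in
       (\<forall>k\<le>m. f k \<in> Hom n (X k) (X (k + 1))) \<and>
       is_mono n (X 0) (X 1) (f 0) \<and>
       is_epi n (X m) (X (m + 1)) (f m) \<and>
       (\<forall>k<m. ker n (X (k + 1)) (X (k + 2)) (f (k + 1)) = im n (X k) (f k)))}"

definition leads_to :: "nat \<Rightarrow> nat \<Rightarrow> 'a rep \<Rightarrow> 'a rep \<Rightarrow> 'a ext \<Rightarrow> 'a ext \<Rightarrow> bool" where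
  "leads_to n m N L e e' \<longleftrightarrow>
     e \<in> extensions n m N L \<and> e' \<in> extensions n m N L \<and>
     (\<exists>\<phi>s. length \<phi>s = m \<and>
       (\<forall>k<m. \<phi>s ! k \<in> Hom n (fst e ! k) (fst e' ! k)) \<and>
       (let \<Phi> = id_mor n L # \<phi>s @ [id_mor n N] in
         \<forall>k\<le>m. comp_mor n (terms N L e ! k) (\<Phi> ! (k + 1)) (maps e ! k)
              = comp_mor n (terms N L e ! k) (maps e' ! k) (\<Phi> ! k)))"

definition ext_equiv :: "nat \<Rightarrow> nat \<Rightarrow> 'a rep \<Rightarrow> 'a rep \<Rightarrow> ('a ext \<times> 'a ext) set" where
  "ext_equiv n m N L = {(e, e'). e \<in> extensions n m N L \<and> e' \<in> extensions n m N L \<and>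
                                 equivclp (leads_to n m N L) e e'}"

definition trivial_ext :: "nat \<Rightarrow> nat \<Rightarrow> 'a::infinite rep \<Rightarrow> 'a rep \<Rightarrow> 'a ext" where
  "trivial_ext n m N L =
    (if m = 1 then ([dsum n L N], [dsum_incl n L, dsum_proj n L N])
     else let Es = L # replicate (m - 2) (zero_rep n) @ [N] in
       (Es, id_mor n L # map (\<lambda>k. zero_mor n (Es ! k) (Es ! (k + 1))) [0..<m - 1] @ [id_mor n N]))"

text \<open>The sum type only serves to give \<open>Ext\<^sup>0\<close>, whose elements are morphisms, and
  \<open>Ext\<^sup>m\<close> for \<open>m \<ge> 1\<close>, whose elements are equivalence classes of extensions, a common type.\<close>

definition Ext :: "nat \<Rightarrow> nat \<Rightarrow> 'a::infinite rep \<Rightarrow> 'a rep \<Rightarrow> ('a mor + 'a ext set) pointed" where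
  "Ext n m N L =
    (if m = 0 then \<lparr>points = Inl ` Hom n N L, base = Inl (zero_mor n N L)\<rparr>
     else \<lparr>points = Inr ` (extensions n m N L // ext_equiv n m N L),
           base = Inr (ext_equiv n m N L `` {trivial_ext n m N L})\<rparr>)"

definition euler_term :: "nat \<Rightarrow> 'a::infinite rep \<Rightarrow> 'a rep \<Rightarrow> nat \<Rightarrow> int" where
  "euler_term n L N i = (-1) ^ i * int (pdim (Ext n i L N))"

text \<open>\<^const>\<open>Sum_any\<close> is the sum over the support of a finitely supported function.\<close>

definition euler_form :: "nat \<Rightarrow> 'a::infinite rep \<Rightarrow> 'a rep \<Rightarrow> int" where
  "euler_form n L N = Sum_any (euler_term n L N)"

end

(* Inside an extension L -> E_m -> ... -> E_1 -> N, let a subrepresentation of E_1 be generated by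
   the unique lifts of the nonzero elements of N, then one of E_2 by the lifts of the elements of
   the first that lie in the image of E_2, and so on; finally add the image of L in E_m.  This is a
   subextension, hence equivalent to the given extension, and its size is bounded in terms of n, m,
   L and N, so Ext^m(N, L) is finite.  An element to be lifted once more has been moved by at least
   one arrow since the previous lift, hence lives at a strictly smaller vertex; for m > n nothing
   is left in E_m besides L and the extension is equivalent to the trivial one.  The same happens
   for every m >= 1 if the arrows of N have no kernel, which makes the Euler form of such an N
   computable: it is the dimension of Hom. *)

theory Submission
  imports Defs
begin

text \<open>Lifts are unique because an F_1-linear map is injective off its kernel. Exactness
  dictates what must be lifted: whatever a subextension keeps of the kernel of one map has to be hit
  by the map before it. A lift of a nonzero element is not in the kernel of its outgoing map, so it
  needs no further lift itself; only what the arrows make of it can fall into that kernel, and every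
  arrow lowers the vertex by one. Morphisms cannot be added, so the argument follows single elements
  through explicit sequences. The inclusion of a subextension is enough for equivalence, because the
  relation generated by \<open>leads_to\<close> may be traversed backwards. Bounded size alone does
  not leave finitely many sequences, as the spaces may be any finite subsets of an infinite type;
  hence the subextension is also copied into one finite set fixed in advance. For the counterexample
  the first argument of the form is chosen with injective arrows, which reduces the comparison to
  counting morphisms.\<close>

section \<open>Pointwise rules for representations and morphisms\<close>

lemma reps_vert:
  assumes "M \<in> reps n" "i \<in> {1..n}"
  shows "finite (points (vert M i))" "base (vert M i) \<in> points (vert M i)"
  using assms unfolding reps_def f1_space_def by auto

lemma f1_linearD:
  assumes "h \<in> f1_linear V W"
  shows "x \<in> points V \<Longrightarrow> h x \<in> points W" "h (base V) = base W"
    "\<lbrakk>x \<in> points V; y \<in> points V; h x = h y; h x \<noteq> base W\<rbrakk> \<Longrightarrow> x = y"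
  using assms unfolding f1_linear_def inj_on_def by auto

lemma f1_linearI:
  assumes "h \<in> extensional (points V)" "\<And>x. x \<in> points V \<Longrightarrow> h x \<in> points W"
    "h (base V) = base W"
    "\<And>x y. \<lbrakk>x \<in> points V; y \<in> points V; h x = h y; h x \<noteq> base W\<rbrakk> \<Longrightarrow> x = y"
  shows "h \<in> f1_linear V W"
  unfolding f1_linear_def inj_on_def PiE_def using assms by auto

lemma reps_arr:
  assumes "M \<in> reps n" "i \<in> {1..<n}"
  shows "x \<in> points (vert M (Suc i)) \<Longrightarrow> arr M i x \<in> points (vert M i)"
    "arr M i (base (vert M (Suc i))) = base (vert M i)"
    "\<lbrakk>x \<in> points (vert M (Suc i)); y \<in> points (vert M (Suc i)); arr M i x = arr M i y;
      arr M i x \<noteq> base (vert M i)\<rbrakk> \<Longrightarrow> x = y"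
proof -
  have "arr M i \<in> f1_linear (vert M (Suc i)) (vert M i)"
    using assms unfolding reps_def by (fastforce dest: PiE_mem)
  note f1_linearD[OF this]
  then show "x \<in> points (vert M (Suc i)) \<Longrightarrow> arr M i x \<in> points (vert M i)"
    "arr M i (base (vert M (Suc i))) = base (vert M i)"
    "\<lbrakk>x \<in> points (vert M (Suc i)); y \<in> points (vert M (Suc i)); arr M i x = arr M i y;
      arr M i x \<noteq> base (vert M i)\<rbrakk> \<Longrightarrow> x = y"
    by blast+
qed

lemma repsI:
  assumes "vert M \<in> extensional {1..n}" "arr M \<in> extensional {1..<n}"
    "\<And>i. i \<in> {1..n} \<Longrightarrow> f1_space (vert M i)"
    "\<And>i. i \<in> {1..<n} \<Longrightarrow> arr M i \<in> f1_linear (vert M (Suc i)) (vert M i)"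
  shows "M \<in> reps n"
  unfolding reps_def PiE_def using assms by auto

lemma HomD:
  assumes "\<phi> \<in> Hom n M N" "i \<in> {1..n}"
  shows "x \<in> points (vert M i) \<Longrightarrow> \<phi> i x \<in> points (vert N i)"
    "\<phi> i (base (vert M i)) = base (vert N i)"
    "\<lbrakk>x \<in> points (vert M i); y \<in> points (vert M i); \<phi> i x = \<phi> i y;
      \<phi> i x \<noteq> base (vert N i)\<rbrakk> \<Longrightarrow> x = y"
proof -
  have "\<phi> i \<in> f1_linear (vert M i) (vert N i)"
    using assms unfolding Hom_def by (auto dest: PiE_mem)
  note f1_linearD[OF this]
  then show "x \<in> points (vert M i) \<Longrightarrow> \<phi> i x \<in> points (vert N i)"
    "\<phi> i (base (vert M i)) = base (vert N i)"
    "\<lbrakk>x \<in> points (vert M i); y \<in> points (vert M i); \<phi> i x = \<phi> i y;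
      \<phi> i x \<noteq> base (vert N i)\<rbrakk> \<Longrightarrow> x = y"
    by blast+
qed

lemma Hom_arr:
  assumes "\<phi> \<in> Hom n M N" "i \<in> {1..<n}" "x \<in> points (vert M (Suc i))"
  shows "\<phi> i (arr M i x) = arr N i (\<phi> (Suc i) x)"
  using assms unfolding Hom_def by auto

lemma HomI:
  assumes "\<phi> \<in> extensional {1..n}"
    "\<And>i. i \<in> {1..n} \<Longrightarrow> \<phi> i \<in> f1_linear (vert M i) (vert N i)"
    "\<And>i x. i \<in> {1..<n} \<Longrightarrow> x \<in> points (vert M (Suc i)) \<Longrightarrow> \<phi> i (arr M i x) = arr N i (\<phi> (Suc i) x)"
  shows "\<phi> \<in> Hom n M N"
  unfolding Hom_def PiE_def using assms by auto

lemma restrict_Hom: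
  assumes "\<And>i x. i \<in> {1..n} \<Longrightarrow> x \<in> points (vert M i) \<Longrightarrow> h i x \<in> points (vert N i)"
    "\<And>i. i \<in> {1..n} \<Longrightarrow> h i (base (vert M i)) = base (vert N i)"
    "\<And>i x y. \<lbrakk>i \<in> {1..n}; x \<in> points (vert M i); y \<in> points (vert M i); h i x = h i y;
      h i x \<noteq> base (vert N i)\<rbrakk> \<Longrightarrow> x = y"
    "\<And>i x. i \<in> {1..<n} \<Longrightarrow> x \<in> points (vert M (Suc i)) \<Longrightarrow> h i (arr M i x) = arr N i (h (Suc i) x)"
    and M: "M \<in> reps n"
  shows "(\<lambda>i\<in>{1..n}. \<lambda>x\<in>points (vert M i). h i x) \<in> Hom n M N"
proof (rule HomI)
  fix i assume i: "i \<in> {1..n}"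
  have "(\<lambda>x\<in>points (vert M i). h i x) \<in> f1_linear (vert M i) (vert N i)"
    by (rule f1_linearI) (use assms(1,2,3) i reps_vert[OF M i] in auto)
  then show "(\<lambda>i\<in>{1..n}. \<lambda>x\<in>points (vert M i). h i x) i \<in> f1_linear (vert M i) (vert N i)"
    using i by simp
next
  fix i x assume i: "i \<in> {1..<n}" and x: "x \<in> points (vert M (Suc i))"
  then show "(\<lambda>i\<in>{1..n}. \<lambda>x\<in>points (vert M i). h i x) i (arr M i x)
    = arr N i ((\<lambda>i\<in>{1..n}. \<lambda>x\<in>points (vert M i). h i x) (Suc i) x)"
    using assms(4)[OF i x] reps_arr(1)[OF M i x] by auto
qed auto

lemma id_mor_Hom: "M \<in> reps n \<Longrightarrow> id_mor n M \<in> Hom n M M"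
  unfolding id_mor_def by (rule restrict_Hom) auto

lemma zero_mor_Hom: "M \<in> reps n \<Longrightarrow> N \<in> reps n \<Longrightarrow> zero_mor n M N \<in> Hom n M N"
  unfolding zero_mor_def
  by (rule restrict_Hom) (auto simp: reps_arr dest: reps_vert)

lemma finite_Hom:
  assumes "M \<in> reps n" "N \<in> reps n"
  shows "finite (Hom n M N)"
proof (rule finite_subset)
  show "Hom n M N \<subseteq> (\<Pi>\<^sub>E i\<in>{1..n}. points (vert M i) \<rightarrow>\<^sub>E points (vert N i))"
    unfolding Hom_def f1_linear_def by (auto simp: PiE_def Pi_def)
  show "finite (\<Pi>\<^sub>E i\<in>{1..n}. points (vert M i) \<rightarrow>\<^sub>E points (vert N i))"
    using assms by (intro finite_PiE) (auto dest: reps_vert)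
qed

section \<open>Exact sequences\<close>

text \<open>Positions run from left to right with the ends included: \<open>X 0\<close> is L,
  \<open>X 1\<close> is \<open>E_m\<close>, \<open>X m\<close> is \<open>E_1\<close> and
  \<open>X (Suc m)\<close> is N. Lifting towards L therefore decreases the index.\<close>

locale exact_seq =
  fixes n m :: nat and X :: "nat \<Rightarrow> 'a rep" and f :: "nat \<Rightarrow> 'a mor"
  assumes rep: "k \<le> Suc m \<Longrightarrow> X k \<in> reps n"
    and hom: "k \<le> m \<Longrightarrow> f k \<in> Hom n (X k) (X (Suc k))"
    and mono: "\<lbrakk>i \<in> {1..n}; x \<in> points (vert (X 0) i); f 0 i x = base (vert (X (Suc 0)) i)\<rbrakk>
      \<Longrightarrow> x = base (vert (X 0) i)"
    and epi: "\<lbrakk>i \<in> {1..n}; y \<in> points (vert (X (Suc m)) i)\<rbrakk>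
      \<Longrightarrow> \<exists>x\<in>points (vert (X m) i). f m i x = y"
    and exact: "\<lbrakk>k < m; i \<in> {1..n}; y \<in> points (vert (X (Suc k)) i)\<rbrakk> \<Longrightarrow>
      f (Suc k) i y = base (vert (X (Suc (Suc k))) i) \<longleftrightarrow> (\<exists>x\<in>points (vert (X k) i). y = f k i x)"

text \<open>The indices 0 and \<open>Suc m\<close> are left out of the first list because an
  extension stores its middle terms only, whereas all \<open>m + 1\<close> maps are stored.\<close>

definition mk_ext :: "nat \<Rightarrow> (nat \<Rightarrow> 'a rep) \<Rightarrow> (nat \<Rightarrow> 'a mor) \<Rightarrow> 'a ext" where
  "mk_ext m X f = (map X [1..<Suc m], map f [0..<Suc m])"

lemma terms_mk_ext:
  assumes "k \<le> Suc m"
  shows "terms (X (Suc m)) (X 0) (mk_ext m X f) ! k = X k"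
proof -
  have "terms (X (Suc m)) (X 0) (mk_ext m X f) = map X [0..<Suc (Suc m)]"
    unfolding terms_def mk_ext_def fst_conv
    by (subst upt_conv_Cons) (auto simp del: upt_Suc simp add: upt_Suc_append)
  then show ?thesis using assms by (simp del: upt_Suc)
qed

lemma maps_mk_ext: "k \<le> m \<Longrightarrow> maps (mk_ext m X f) ! k = f k"
  unfolding maps_def mk_ext_def by (simp del: upt_Suc)

lemma restrict_eq_iff:
  "(\<lambda>i\<in>A. F i) = (\<lambda>i\<in>A. G i) \<longleftrightarrow> (\<forall>i\<in>A. F i = G i)"
  by (auto simp: fun_eq_iff restrict_def)

lemma is_mono_iff:
  assumes "f \<in> Hom n M N" "M \<in> reps n"
  shows "is_mono n M N f \<longleftrightarrow>
    (\<forall>i\<in>{1..n}. \<forall>x\<in>points (vert M i). f i x = base (vert N i) \<longrightarrow> x = base (vert M i))"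
proof -
  have "is_mono n M N f \<longleftrightarrow>
    (\<forall>i\<in>{1..n}. {x \<in> points (vert M i). f i x = base (vert N i)} = {base (vert M i)})"
    unfolding is_mono_def ker_def restrict_eq_iff ..
  then show ?thesis using HomD(2)[OF assms(1)] reps_vert(2)[OF assms(2)] by blast
qed

lemma is_epi_iff:
  assumes "f \<in> Hom n M N"
  shows "is_epi n M N f \<longleftrightarrow>
    (\<forall>i\<in>{1..n}. \<forall>y\<in>points (vert N i). \<exists>x\<in>points (vert M i). f i x = y)"
proof -
  have "is_epi n M N f \<longleftrightarrow> (\<forall>i\<in>{1..n}. f i ` points (vert M i) = points (vert N i))"
    unfolding is_epi_def im_def restrict_eq_iff ..
  moreover have "f i ` points (vert M i) = points (vert N i) \<longleftrightarrow>
      (\<forall>y\<in>points (vert N i). \<exists>x\<in>points (vert M i). f i x = y)" if "i \<in> {1..n}" for i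
  proof -
    have "f i ` points (vert M i) \<subseteq> points (vert N i)" using HomD(1)[OF assms that] by blast
    then show ?thesis by (simp add: set_eq_subset subset_iff image_iff) metis
  qed
  ultimately show ?thesis by simp
qed

lemma ker_eq_im_iff:
  assumes "f \<in> Hom n L M" "g \<in> Hom n M N"
  shows "ker n M N g = im n L f \<longleftrightarrow>
    (\<forall>i\<in>{1..n}. \<forall>y\<in>points (vert M i).
      g i y = base (vert N i) \<longleftrightarrow> (\<exists>x\<in>points (vert L i). y = f i x))"
proof -
  have "ker n M N g = im n L f \<longleftrightarrow>
    (\<forall>i\<in>{1..n}. {y \<in> points (vert M i). g i y = base (vert N i)} = f i ` points (vert L i))"
    unfolding ker_def im_def restrict_eq_iff ..
  then show ?thesis using HomD(1)[OF assms(1)] by blast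
qed

text \<open>This is the passage from lists, kernels and images to families and elements; later
  arguments about exactness stay on the side of \<open>exact_seq\<close>.\<close>

lemma mk_ext_in_extensions_iff:
  assumes "X 0 \<in> reps n" "X (Suc m) \<in> reps n"
  shows "mk_ext m X f \<in> extensions n m (X (Suc m)) (X 0) \<longleftrightarrow> exact_seq n m X f"
proof -
  have st: "set (fst (mk_ext m X f)) \<subseteq> reps n \<longleftrightarrow> (\<forall>k\<le>Suc m. X k \<in> reps n)"
  proof -
    have "set (fst (mk_ext m X f)) = X ` {1..m}"
      unfolding mk_ext_def by (auto simp del: upt_Suc)
    moreover have "{..Suc m} = insert 0 (insert (Suc m) {1..m})" by auto
    ultimately show ?thesis using assms
      unfolding atMost_iff[symmetric, of _ "Suc m"] by (simp only: Ball_def[symmetric] image_subset_iff) simp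
  qed
  have len: "length (fst (mk_ext m X f)) = m" "length (maps (mk_ext m X f)) = m + 1"
    unfolding mk_ext_def maps_def by auto
  have E: "mk_ext m X f \<in> extensions n m (X (Suc m)) (X 0) \<longleftrightarrow>
     (\<forall>k\<le>Suc m. X k \<in> reps n) \<and> (\<forall>k\<le>m. f k \<in> Hom n (X k) (X (Suc k))) \<and>
       is_mono n (X 0) (X (Suc 0)) (f 0) \<and> is_epi n (X m) (X (Suc m)) (f m) \<and>
       (\<forall>k<m. ker n (X (Suc k)) (X (Suc (Suc k))) (f (Suc k)) = im n (X k) (f k))"
    unfolding extensions_def mem_Collect_eq st len Let_def
    by (auto simp: terms_mk_ext maps_mk_ext)
  show ?thesis
    unfolding E
  proof (intro iffI conjI; (elim conjE)?)
    assume rep: "\<forall>k\<le>Suc m. X k \<in> reps n" and hom: "\<forall>k\<le>m. f k \<in> Hom n (X k) (X (Suc k))"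
      and mono: "is_mono n (X 0) (X (Suc 0)) (f 0)" and epi: "is_epi n (X m) (X (Suc m)) (f m)"
      and ex: "\<forall>k<m. ker n (X (Suc k)) (X (Suc (Suc k))) (f (Suc k)) = im n (X k) (f k)"
    show "exact_seq n m X f"
    proof
      show "f (Suc k) i y = base (vert (X (Suc (Suc k))) i) \<longleftrightarrow>
          (\<exists>x\<in>points (vert (X k) i). y = f k i x)"
        if "k < m" "i \<in> {1..n}" "y \<in> points (vert (X (Suc k)) i)" for k i y
        using ker_eq_im_iff[of "f k" n "X k" "X (Suc k)" "f (Suc k)" "X (Suc (Suc k))"]
          hom ex that by auto
    qed (use rep hom mono epi is_mono_iff[of "f 0" n "X 0" "X (Suc 0)"]
      is_epi_iff[of "f m" n "X m" "X (Suc m)"] in auto)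
  next
    assume "exact_seq n m X f"
    then interpret exact_seq n m X f .
    show "\<forall>k\<le>Suc m. X k \<in> reps n" "\<forall>k\<le>m. f k \<in> Hom n (X k) (X (Suc k))"
      using rep hom by blast+
    show "is_mono n (X 0) (X (Suc 0)) (f 0)"
      using is_mono_iff[of "f 0" n "X 0" "X (Suc 0)"] mono rep hom by blast
    show "is_epi n (X m) (X (Suc m)) (f m)"
      using is_epi_iff[of "f m" n "X m" "X (Suc m)"] epi hom by blast
    show "\<forall>k<m. ker n (X (Suc k)) (X (Suc (Suc k))) (f (Suc k)) = im n (X k) (f k)"
    proof (intro allI impI)
      fix k assume k: "k < m"
      show "ker n (X (Suc k)) (X (Suc (Suc k))) (f (Suc k)) = im n (X k) (f k)"
        using ker_eq_im_iff[OF hom[of k] hom[of "Suc k"]] exact[OF k] k by simp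
    qed
  qed
qed

lemma extensionsE:
  assumes "e \<in> extensions n m N L" "L \<in> reps n" "N \<in> reps n"
  obtains X f where "e = mk_ext m X f" "exact_seq n m X f" "X 0 = L" "X (Suc m) = N"
proof -
  let ?X = "\<lambda>k. terms N L e ! k" and ?f = "\<lambda>k. maps e ! k"
  have len: "length (fst e) = m" "length (snd e) = Suc m"
    using assms(1) unfolding extensions_def maps_def by auto
  have X: "?X 0 = L" "?X (Suc m) = N"
    unfolding terms_def using len by (auto simp: nth_append)
  have "map ?X [1..<Suc m] = fst e"
    using len by (intro nth_equalityI) (auto simp: terms_def nth_append simp del: upt_Suc)
  moreover have "map ?f [0..<Suc m] = snd e"
    using len by (intro nth_equalityI) (auto simp: maps_def simp del: upt_Suc)
  ultimately have e: "e = mk_ext m ?X ?f"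
    unfolding mk_ext_def by (simp del: upt_Suc)
  have "exact_seq n m ?X ?f"
    using mk_ext_in_extensions_iff[of ?X n m ?f] assms e X by simp
  then show thesis using that e X by blast
qed

text \<open>Extending the family \<open>\<phi>\<close> by the identities at both ends turns the
  outer triangles into squares like all the others.\<close>

lemma leads_to_mk_ext:
  assumes XX: "exact_seq n m X f" "exact_seq n m X' f'" "X' 0 = X 0" "X' (Suc m) = X (Suc m)"
    and \<phi>: "\<And>k. k \<in> {1..m} \<Longrightarrow> \<phi> k \<in> Hom n (X k) (X' k)"
      "\<phi> 0 = id_mor n (X 0)" "\<phi> (Suc m) = id_mor n (X (Suc m))"
    and sq: "\<And>k i x. \<lbrakk>k \<le> m; i \<in> {1..n}; x \<in> points (vert (X k) i)\<rbrakk>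
      \<Longrightarrow> \<phi> (Suc k) i (f k i x) = f' k i (\<phi> k i x)"
  shows "leads_to n m (X (Suc m)) (X 0) (mk_ext m X f) (mk_ext m X' f')"
proof -
  have rep: "X 0 \<in> reps n" "X (Suc m) \<in> reps n"
    using exact_seq.rep[OF XX(1)] by auto
  have e: "mk_ext m X f \<in> extensions n m (X (Suc m)) (X 0)"
    using mk_ext_in_extensions_iff[of X n m f] rep XX(1) by simp
  have e': "mk_ext m X' f' \<in> extensions n m (X (Suc m)) (X 0)"
    using mk_ext_in_extensions_iff[of X' n m f'] rep XX by simp
  define \<phi>s where "\<phi>s = map \<phi> [1..<Suc m]"
  have \<Phi>: "(id_mor n (X 0) # \<phi>s @ [id_mor n (X (Suc m))]) ! k = \<phi> k" if "k \<le> Suc m" for k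
  proof -
    have "id_mor n (X 0) # \<phi>s @ [id_mor n (X (Suc m))] = map \<phi> [0..<Suc (Suc m)]"
      unfolding \<phi>s_def \<phi>(2,3)[symmetric]
      by (subst (2) upt_conv_Cons) (auto simp del: upt_Suc simp add: upt_Suc_append)
    then show ?thesis using that by (simp del: upt_Suc)
  qed
  show ?thesis
    unfolding leads_to_def Let_def
  proof (intro conjI e e' exI[of _ \<phi>s] allI impI)
    show "length \<phi>s = m" unfolding \<phi>s_def by simp
    fix k assume "k < m"
    then show "\<phi>s ! k \<in> Hom n (fst (mk_ext m X f) ! k) (fst (mk_ext m X' f') ! k)"
      unfolding \<phi>s_def mk_ext_def using \<phi>(1)[of "Suc k"] by (simp del: upt_Suc)
  next
    fix k assume k: "k \<le> m"
    have t: "terms (X (Suc m)) (X 0) (mk_ext m X f) ! k = X k"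
      using k by (intro terms_mk_ext) simp
    show "comp_mor n (terms (X (Suc m)) (X 0) (mk_ext m X f) ! k)
        ((id_mor n (X 0) # \<phi>s @ [id_mor n (X (Suc m))]) ! (k + 1)) (maps (mk_ext m X f) ! k) =
      comp_mor n (terms (X (Suc m)) (X 0) (mk_ext m X f) ! k)
        (maps (mk_ext m X' f') ! k) ((id_mor n (X 0) # \<phi>s @ [id_mor n (X (Suc m))]) ! k)"
      unfolding t maps_mk_ext[OF k] comp_mor_def compose_def
      unfolding restrict_eq_iff using k sq by (simp only: \<Phi> Suc_eq_plus1[symmetric] Suc_le_mono le_SucI) simp
  qed
qed

section \<open>Subrepresentations, their copies, and the exact sequences they carry\<close>

text \<open>The renaming \<open>g\<close> is what later places a subrepresentation inside a
  prescribed finite set. The embedding \<open>\<phi>\<close> undoes the renaming.\<close>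

lemma subrep_copy:
  assumes M: "M \<in> reps n"
    and A: "\<And>i. i \<in> {1..n} \<Longrightarrow> A i \<subseteq> points (vert M i)"
      "\<And>i. i \<in> {1..n} \<Longrightarrow> base (vert M i) \<in> A i"
      "\<And>i x. \<lbrakk>i \<in> {1..<n}; x \<in> A (Suc i)\<rbrakk> \<Longrightarrow> arr M i x \<in> A i"
    and g: "\<And>i. i \<in> {1..n} \<Longrightarrow> inj_on (g i) (A i)"
  obtains M' \<phi> where "M' \<in> reps n" "\<phi> \<in> Hom n M' M"
    "\<And>i. i \<in> {1..n} \<Longrightarrow> points (vert M' i) = g i ` A i"
    "\<And>i. i \<in> {1..n} \<Longrightarrow> inj_on (\<phi> i) (points (vert M' i))"
    "\<And>i. i \<in> {1..n} \<Longrightarrow> \<phi> i ` points (vert M' i) = A i"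
proof -
  define h where "h i = inv_into (A i) (g i)" for i
  have h: "h i (g i x) = x" if "i \<in> {1..n}" "x \<in> A i" for i x
    using g that by (simp add: h_def)
  define M' where "M' = \<lparr>vert = (\<lambda>i\<in>{1..n}. \<lparr>points = g i ` A i, base = g i (base (vert M i))\<rparr>),
    arr = (\<lambda>i\<in>{1..<n}. \<lambda>y\<in>g (Suc i) ` A (Suc i). g i (arr M i (h (Suc i) y)))\<rparr>"
  have v: "vert M' i = \<lparr>points = g i ` A i, base = g i (base (vert M i))\<rparr>" if "i \<in> {1..n}" for i
    using that by (simp add: M'_def)
  have a: "arr M' i (g (Suc i) x) = g i (arr M i x)" if "i \<in> {1..<n}" "x \<in> A (Suc i)" for i x
    using that h[of "Suc i" x] by (simp add: M'_def)
  have M': "M' \<in> reps n"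
  proof (rule repsI)
    fix i assume "i \<in> {1..n}"
    then show "f1_space (vert M' i)"
      using A(2)[of i] finite_subset[OF A(1)[of i] reps_vert(1)[OF M, of i]]
      by (auto simp: v f1_space_def)
  next
    fix i assume i: "i \<in> {1..<n}"
    then have i': "i \<in> {1..n}" "Suc i \<in> {1..n}" by auto
    show "arr M' i \<in> f1_linear (vert M' (Suc i)) (vert M' i)"
    proof (rule f1_linearI)
      show "arr M' i \<in> extensional (points (vert M' (Suc i)))"
        using i v[OF i'(2)] by (simp add: M'_def)
      show "arr M' i x \<in> points (vert M' i)" if "x \<in> points (vert M' (Suc i))" for x
        using that v i' a[OF i] A(3)[OF i] by auto
      show "arr M' i (base (vert M' (Suc i))) = base (vert M' i)"
        using v i' a[OF i A(2)[OF i'(2)]] reps_arr(2)[OF M i] by simp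
      show "x = y" if "x \<in> points (vert M' (Suc i))" "y \<in> points (vert M' (Suc i))"
        "arr M' i x = arr M' i y" "arr M' i x \<noteq> base (vert M' i)" for x y
      proof -
        have "x \<in> g (Suc i) ` A (Suc i)" "y \<in> g (Suc i) ` A (Suc i)"
          using that(1,2) v[OF i'(2)] by auto
        then obtain x' y' where xy: "x' \<in> A (Suc i)" "y' \<in> A (Suc i)"
            "x = g (Suc i) x'" "y = g (Suc i) y'"
          by blast
        then have "g i (arr M i x') = g i (arr M i y')" "arr M i x' \<noteq> base (vert M i)"
          using that a[OF i] v[OF i'(1)] by auto
        then have "arr M i x' = arr M i y'"
          using g[OF i'(1)] A(3)[OF i] xy by (meson inj_on_eq_iff)
        then show ?thesis
          using reps_arr(3)[OF M i] xy A(1)[OF i'(2)] \<open>arr M i x' \<noteq> _\<close> by blast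
      qed
    qed
  qed (auto simp: M'_def)
  define \<phi> where "\<phi> = (\<lambda>i\<in>{1..n}. \<lambda>x\<in>points (vert M' i). h i x)"
  have \<phi>_eq: "\<phi> i (g i x) = x" if "i \<in> {1..n}" "x \<in> A i" for i x
    using that by (simp add: \<phi>_def v h)
  have "\<phi> \<in> Hom n M' M"
    unfolding \<phi>_def
  proof (rule restrict_Hom)
    fix i x assume i: "i \<in> {1..<n}" and x: "x \<in> points (vert M' (Suc i))"
    then have "Suc i \<in> {1..n}" "i \<in> {1..n}" by auto
    moreover from this x obtain x' where "x' \<in> A (Suc i)" "x = g (Suc i) x'" using v by auto
    ultimately show "h i (arr M' i x) = arr M i (h (Suc i) x)"
      using a[OF i] A(3)[OF i] by (simp add: h)
  qed (use A(1)[THEN subsetD] A(2) M' in \<open>auto simp: v h\<close>)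
  moreover have "inj_on (\<phi> i) (points (vert M' i)) \<and> \<phi> i ` points (vert M' i) = A i"
    if "i \<in> {1..n}" for i
    using that \<phi>_eq[OF that] by (auto simp: v inj_on_def image_image)
  ultimately show thesis
    using that M' v by (metis pointed.select_convs(1))
qed

lemma id_mor_apply: "i \<in> {1..n} \<Longrightarrow> x \<in> points (vert M i) \<Longrightarrow> id_mor n M i x = x"
  by (simp add: id_mor_def)

context exact_seq
begin

text \<open>Since every \<open>\<phi> k\<close> is injective, the maps between the subobjects are
  forced, and compatibility with arrows, injectivity off the kernel and the monomorphism at the left
  are inherited from \<open>f\<close>. What subobjects do not inherit is that kernels are hit and
  that the last map is onto; \<open>lift\<close> and \<open>onto\<close> supply exactly
  this.\<close>

lemma pullback:
  assumes X': "\<And>k. k \<le> Suc m \<Longrightarrow> X' k \<in> reps n" "X' 0 = X 0" "X' (Suc m) = X (Suc m)"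
    and \<phi>: "\<And>k. k \<le> Suc m \<Longrightarrow> \<phi> k \<in> Hom n (X' k) (X k)"
      "\<And>k i. \<lbrakk>k \<le> Suc m; i \<in> {1..n}\<rbrakk> \<Longrightarrow> inj_on (\<phi> k i) (points (vert (X' k) i))"
      "\<phi> 0 = id_mor n (X 0)" "\<phi> (Suc m) = id_mor n (X (Suc m))"
    and closed: "\<And>k i x. \<lbrakk>k \<le> m; i \<in> {1..n}; x \<in> points (vert (X' k) i)\<rbrakk> \<Longrightarrow>
      f k i (\<phi> k i x) \<in> \<phi> (Suc k) i ` points (vert (X' (Suc k)) i)"
    and lift: "\<And>k i y. \<lbrakk>k < m; i \<in> {1..n}; y \<in> points (vert (X' (Suc k)) i);
      f (Suc k) i (\<phi> (Suc k) i y) = base (vert (X (Suc (Suc k))) i)\<rbrakk> \<Longrightarrow>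
      \<exists>x\<in>points (vert (X' k) i). \<phi> (Suc k) i y = f k i (\<phi> k i x)"
    and onto: "\<And>i y. \<lbrakk>i \<in> {1..n}; y \<in> points (vert (X (Suc m)) i)\<rbrakk> \<Longrightarrow>
      \<exists>x\<in>points (vert (X' m) i). f m i (\<phi> m i x) = y"
  obtains f' where "exact_seq n m X' f'"
    "\<And>k i x. \<lbrakk>k \<le> m; i \<in> {1..n}; x \<in> points (vert (X' k) i)\<rbrakk>
      \<Longrightarrow> \<phi> (Suc k) i (f' k i x) = f k i (\<phi> k i x)"
    "leads_to n m (X (Suc m)) (X 0) (mk_ext m X' f') (mk_ext m X f)"
proof -
  \<comment> \<open>The restriction of \<open>f k\<close> to the subobjects, read through the
    embeddings; \<open>closed\<close> makes the inverse image exist.\<close>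
  define h where "h k i x = inv_into (points (vert (X' (Suc k)) i)) (\<phi> (Suc k) i) (f k i (\<phi> k i x))"
    for k i x
  have h: "h k i x \<in> points (vert (X' (Suc k)) i)" "\<phi> (Suc k) i (h k i x) = f k i (\<phi> k i x)"
    if "k \<le> m" "i \<in> {1..n}" "x \<in> points (vert (X' k) i)" for k i x
    unfolding h_def using closed[OF that] by (auto intro: inv_into_into f_inv_into_f)
  have \<phi>_inj: "x = y" if "k \<le> Suc m" "i \<in> {1..n}" "\<phi> k i x = \<phi> k i y"
    "x \<in> points (vert (X' k) i)" "y \<in> points (vert (X' k) i)" for k i x y
    using \<phi>(2)[OF that(1,2)] that(3-) by (auto dest: inj_onD)
  have \<phi>_base: "\<phi> k i x = base (vert (X k) i) \<longleftrightarrow> x = base (vert (X' k) i)"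
    if "k \<le> Suc m" "i \<in> {1..n}" "x \<in> points (vert (X' k) i)" for k i x
    using \<phi>_inj[OF that(1,2)] that(3) HomD(2)[OF \<phi>(1)[OF that(1)] that(2)]
      reps_vert(2)[OF X'(1)[OF that(1)] that(2)] by metis
  define f' where "f' k = (\<lambda>i\<in>{1..n}. \<lambda>x\<in>points (vert (X' k) i). h k i x)" for k
  have f': "f' k i x = h k i x" if "i \<in> {1..n}" "x \<in> points (vert (X' k) i)" for k i x
    using that by (simp add: f'_def)
  have h_base: "h k i x = base (vert (X' (Suc k)) i) \<longleftrightarrow> f k i (\<phi> k i x) = base (vert (X (Suc k)) i)"
    if "k \<le> m" "i \<in> {1..n}" "x \<in> points (vert (X' k) i)" for k i x
    using \<phi>_base[of "Suc k" i "h k i x"] h[OF that] that by simp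
  have hom': "f' k \<in> Hom n (X' k) (X' (Suc k))" if k: "k \<le> m" for k
    unfolding f'_def
  proof (rule restrict_Hom)
    have rk: "X' k \<in> reps n" "\<phi> k \<in> Hom n (X' k) (X k)" "f k \<in> Hom n (X k) (X (Suc k))"
      "X' (Suc k) \<in> reps n" "\<phi> (Suc k) \<in> Hom n (X' (Suc k)) (X (Suc k))"
      using k X'(1) \<phi>(1) hom by simp_all
    fix i
    {
      assume i: "i \<in> {1..n}"
      show "h k i (base (vert (X' k) i)) = base (vert (X' (Suc k)) i)"
        using h_base[OF k i reps_vert(2)[OF rk(1) i]] HomD(2)[OF rk(2) i] HomD(2)[OF rk(3) i]
        by simp
      fix x assume x: "x \<in> points (vert (X' k) i)"
      show "h k i x \<in> points (vert (X' (Suc k)) i)" using h k i x by blast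
      fix y assume y: "y \<in> points (vert (X' k) i)"
        and xy: "h k i x = h k i y" "h k i x \<noteq> base (vert (X' (Suc k)) i)"
      have "f k i (\<phi> k i x) = f k i (\<phi> k i y)" "f k i (\<phi> k i x) \<noteq> base (vert (X (Suc k)) i)"
        using xy h(2)[OF k i x] h(2)[OF k i y] h_base[OF k i x] by auto
      then have "\<phi> k i x = \<phi> k i y"
        using HomD(3)[OF rk(3) i] HomD(1)[OF rk(2) i] x y by blast
      then show "x = y" using \<phi>_inj[of k] i x y k by simp
    next
      assume i: "i \<in> {1..<n}"
      then have i': "i \<in> {1..n}" "Suc i \<in> {1..n}" by auto
      fix x assume x: "x \<in> points (vert (X' k) (Suc i))"
      have "\<phi> (Suc k) i (h k i (arr (X' k) i x)) = f k i (\<phi> k i (arr (X' k) i x))"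
        using h(2)[OF k i'(1) reps_arr(1)[OF rk(1) i x]] .
      also have "\<dots> = arr (X (Suc k)) i (f k (Suc i) (\<phi> k (Suc i) x))"
        using Hom_arr[OF rk(2) i x] Hom_arr[OF rk(3) i HomD(1)[OF rk(2) i'(2) x]] by simp
      also have "\<dots> = arr (X (Suc k)) i (\<phi> (Suc k) (Suc i) (h k (Suc i) x))"
        using h(2)[OF k i'(2) x] by simp
      also have "\<dots> = \<phi> (Suc k) i (arr (X' (Suc k)) i (h k (Suc i) x))"
        using Hom_arr[OF rk(5) i h(1)[OF k i'(2) x]] by simp
      finally show "h k i (arr (X' k) i x) = arr (X' (Suc k)) i (h k (Suc i) x)"
        using \<phi>_inj[of "Suc k" i] k i' h(1)[OF k i'(1) reps_arr(1)[OF rk(1) i x]]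
          reps_arr(1)[OF rk(4) i h(1)[OF k i'(2) x]] by simp
    }
  qed (use X' k in auto)
  have ex': "exact_seq n m X' f'"
  proof
    show "f' k \<in> Hom n (X' k) (X' (Suc k))" if "k \<le> m" for k by (fact hom'[OF that])
    show "X' k \<in> reps n" if "k \<le> Suc m" for k by (fact X'(1)[OF that])
  next
    fix i x assume i: "i \<in> {1..n}" and x: "x \<in> points (vert (X' 0) i)"
      and "f' 0 i x = base (vert (X' (Suc 0)) i)"
    then have "f 0 i (\<phi> 0 i x) = base (vert (X (Suc 0)) i)" using h_base[of 0 i x] f'[of i x 0] by simp
    then show "x = base (vert (X' 0) i)"
      using mono[OF i] \<phi>_base[of 0 i x] HomD(1)[OF \<phi>(1)[of 0] i x] i x by simp
  next
    fix i y assume i: "i \<in> {1..n}" and y: "y \<in> points (vert (X' (Suc m)) i)"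
    then obtain x where x: "x \<in> points (vert (X' m) i)" "f m i (\<phi> m i x) = y"
      using onto[OF i] X'(3) by auto
    have "\<phi> (Suc m) i (f' m i x) = \<phi> (Suc m) i y"
      using h(2)[OF _ i x(1)] f'[OF i x(1)] x(2) y i \<phi>(4) X'(3) by (simp add: id_mor_apply)
    then have "f' m i x = y"
      using \<phi>_inj[of "Suc m" i "f' m i x" y] i y h(1)[OF _ i x(1)] f'[OF i x(1)] by simp
    then show "\<exists>x\<in>points (vert (X' m) i). f' m i x = y" using x by blast
  next
    fix k i y assume k: "k < m" and i: "i \<in> {1..n}" and y: "y \<in> points (vert (X' (Suc k)) i)"
    have rk: "\<phi> k \<in> Hom n (X' k) (X k)" "\<phi> (Suc k) \<in> Hom n (X' (Suc k)) (X (Suc k))"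
      using k \<phi>(1)[of k] \<phi>(1)[of "Suc k"] by simp_all
    have "f' (Suc k) i y = base (vert (X' (Suc (Suc k))) i) \<longleftrightarrow>
        f (Suc k) i (\<phi> (Suc k) i y) = base (vert (X (Suc (Suc k))) i)"
      using f'[OF i y] h_base[OF _ i y] k by simp
    also have "\<dots> \<longleftrightarrow> (\<exists>x\<in>points (vert (X' k) i). \<phi> (Suc k) i y = f k i (\<phi> k i x))"
      using lift[OF k i y] exact[OF k i HomD(1)[OF rk(2) i y]] HomD(1)[OF rk(1) i] by metis
    also have "\<dots> \<longleftrightarrow> (\<exists>x\<in>points (vert (X' k) i). y = h k i x)"
    proof (rule bex_cong[OF refl])
      fix x assume x: "x \<in> points (vert (X' k) i)"
      show "\<phi> (Suc k) i y = f k i (\<phi> k i x) \<longleftrightarrow> y = h k i x"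
        using h[of k i x] k i x y \<phi>_inj[of "Suc k" i y "h k i x"] by auto
    qed
    also have "\<dots> \<longleftrightarrow> (\<exists>x\<in>points (vert (X' k) i). y = f' k i x)"
      using f'[OF i] by metis
    finally show "f' (Suc k) i y = base (vert (X' (Suc (Suc k))) i) \<longleftrightarrow>
      (\<exists>x\<in>points (vert (X' k) i). y = f' k i x)" .
  qed
  have sq: "\<phi> (Suc k) i (f' k i x) = f k i (\<phi> k i x)"
    if "k \<le> m" "i \<in> {1..n}" "x \<in> points (vert (X' k) i)" for k i x
    using h(2)[OF that] f'[OF that(2,3)] by simp
  have "leads_to n m (X' (Suc m)) (X' 0) (mk_ext m X' f') (mk_ext m X f)"
  proof (rule leads_to_mk_ext[OF ex' exact_seq_axioms, where \<phi> = \<phi>])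
    show "\<phi> k \<in> Hom n (X' k) (X k)" if "k \<in> {1..m}" for k using that \<phi>(1) by simp
  qed (use X'(2,3) \<phi>(3,4) sq in simp_all)
  then show thesis using that[OF ex' sq] X' by simp
qed

text \<open>Besides closure under arrows and under the maps, only \<open>lift\<close> is demanded:
  what has a preimage in \<open>X k\<close> must have one in \<open>A k\<close>. In the middle this
  keeps the sequence exact, and at the full right end it keeps the last map onto. The ends are whole
  and are not renamed, so the result extends the same pair of objects.\<close>

lemma subextension:
  assumes A: "\<And>k i. \<lbrakk>k \<le> Suc m; i \<in> {1..n}\<rbrakk> \<Longrightarrow> A k i \<subseteq> points (vert (X k) i)"
      "\<And>k i. \<lbrakk>k \<le> Suc m; i \<in> {1..n}\<rbrakk> \<Longrightarrow> base (vert (X k) i) \<in> A k i"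
      "\<And>k i x. \<lbrakk>k \<le> Suc m; i \<in> {1..<n}; x \<in> A k (Suc i)\<rbrakk> \<Longrightarrow> arr (X k) i x \<in> A k i"
      "\<And>i. i \<in> {1..n} \<Longrightarrow> A 0 i = points (vert (X 0) i)"
      "\<And>i. i \<in> {1..n} \<Longrightarrow> A (Suc m) i = points (vert (X (Suc m)) i)"
    and closed: "\<And>k i x. \<lbrakk>k \<le> m; i \<in> {1..n}; x \<in> A k i\<rbrakk> \<Longrightarrow> f k i x \<in> A (Suc k) i"
    and lift: "\<And>k i x. \<lbrakk>k \<le> m; i \<in> {1..n}; x \<in> points (vert (X k) i); f k i x \<in> A (Suc k) i\<rbrakk>
      \<Longrightarrow> f k i x \<in> f k i ` A k i"
    and g: "\<And>k i. \<lbrakk>k \<in> {1..m}; i \<in> {1..n}\<rbrakk> \<Longrightarrow> inj_on (g k i) (A k i)"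
  obtains X' f' \<phi> where "exact_seq n m X' f'" "X' 0 = X 0" "X' (Suc m) = X (Suc m)"
    "\<And>k i. \<lbrakk>k \<in> {1..m}; i \<in> {1..n}\<rbrakk> \<Longrightarrow> points (vert (X' k) i) = g k i ` A k i"
    "\<And>k. k \<le> Suc m \<Longrightarrow> \<phi> k \<in> Hom n (X' k) (X k)"
    "\<And>k i. \<lbrakk>k \<le> Suc m; i \<in> {1..n}\<rbrakk> \<Longrightarrow> inj_on (\<phi> k i) (points (vert (X' k) i))"
    "\<And>k i. \<lbrakk>k \<le> Suc m; i \<in> {1..n}\<rbrakk> \<Longrightarrow> \<phi> k i ` points (vert (X' k) i) = A k i"
    "\<And>k i x. \<lbrakk>k \<le> m; i \<in> {1..n}; x \<in> points (vert (X' k) i)\<rbrakk>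
      \<Longrightarrow> \<phi> (Suc k) i (f' k i x) = f k i (\<phi> k i x)"
    "leads_to n m (X (Suc m)) (X 0) (mk_ext m X' f') (mk_ext m X f)"
proof -
  \<comment> \<open>All choices for one position are bundled, so that a single choice over
    \<open>k\<close> yields the terms and the embeddings together. Positions 0 and
    \<open>Suc m\<close> get the identity.\<close>
  define Q where "Q k M \<psi> \<longleftrightarrow> M \<in> reps n \<and> \<psi> \<in> Hom n M (X k) \<and>
    (\<forall>i\<in>{1..n}. inj_on (\<psi> i) (points (vert M i)) \<and> \<psi> i ` points (vert M i) = A k i) \<and>
    (k \<in> {1..m} \<longrightarrow> (\<forall>i\<in>{1..n}. points (vert M i) = g k i ` A k i)) \<and>
    (k \<notin> {1..m} \<longrightarrow> M = X k \<and> \<psi> = id_mor n (X k))" for k M \<psi>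
  have "\<forall>k\<in>{..Suc m}. \<exists>p. Q k (fst p) (snd p)"
  proof
    fix k assume "k \<in> {..Suc m}"
    then have k: "k \<le> Suc m" by simp
    show "\<exists>p. Q k (fst p) (snd p)"
    proof (cases "k \<in> {1..m}")
      case True
      then obtain M \<psi> where "M \<in> reps n" "\<psi> \<in> Hom n M (X k)"
        "\<And>i. i \<in> {1..n} \<Longrightarrow> points (vert M i) = g k i ` A k i"
        "\<And>i. i \<in> {1..n} \<Longrightarrow> inj_on (\<psi> i) (points (vert M i))"
        "\<And>i. i \<in> {1..n} \<Longrightarrow> \<psi> i ` points (vert M i) = A k i"
        using subrep_copy[OF rep[OF k] A(1,2,3)[OF k] g[OF True]] by blast
      then have "Q k M \<psi>" unfolding Q_def using True by blast
      then show ?thesis by (metis fst_conv snd_conv)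
    next
      case False
      then have "k = 0 \<or> k = Suc m" using k by auto
      then have "A k i = points (vert (X k) i)" if "i \<in> {1..n}" for i using A(4,5)[OF that] by auto
      then have "Q k (X k) (id_mor n (X k))"
        unfolding Q_def using False rep[OF k] id_mor_Hom[OF rep[OF k]]
        by (auto simp: inj_on_def id_mor_apply)
      then show ?thesis by (metis fst_conv snd_conv)
    qed
  qed
  then obtain p where p: "\<And>k. k \<le> Suc m \<Longrightarrow> Q k (fst (p k)) (snd (p k))"
    by (metis atMost_iff)
  define X' \<phi> where "X' k = fst (p k)" and "\<phi> k = snd (p k)" for k
  have X': "\<And>k. k \<le> Suc m \<Longrightarrow> X' k \<in> reps n" "X' 0 = X 0" "X' (Suc m) = X (Suc m)"
     "\<And>k i. \<lbrakk>k \<in> {1..m}; i \<in> {1..n}\<rbrakk> \<Longrightarrow> points (vert (X' k) i) = g k i ` A k i"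
    using p unfolding Q_def X'_def by auto
  have \<phi>: "\<And>k. k \<le> Suc m \<Longrightarrow> \<phi> k \<in> Hom n (X' k) (X k)"
      "\<And>k i. \<lbrakk>k \<le> Suc m; i \<in> {1..n}\<rbrakk> \<Longrightarrow> inj_on (\<phi> k i) (points (vert (X' k) i))"
      "\<phi> 0 = id_mor n (X 0)" "\<phi> (Suc m) = id_mor n (X (Suc m))"
      "\<And>k i. \<lbrakk>k \<le> Suc m; i \<in> {1..n}\<rbrakk> \<Longrightarrow> \<phi> k i ` points (vert (X' k) i) = A k i"
    using p unfolding Q_def X'_def \<phi>_def by auto
  show thesis
  proof (rule pullback[OF X'(1-3) \<phi>(1-4)])
    fix k i x assume k: "k \<le> m" and i: "i \<in> {1..n}" and "x \<in> points (vert (X' k) i)"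
    then show "f k i (\<phi> k i x) \<in> \<phi> (Suc k) i ` points (vert (X' (Suc k)) i)"
      using \<phi>(5)[of k i] \<phi>(5)[of "Suc k" i] closed[OF k i] by auto
  next
    fix k i y assume k: "k < m" and i: "i \<in> {1..n}" and y: "y \<in> points (vert (X' (Suc k)) i)"
      and b: "f (Suc k) i (\<phi> (Suc k) i y) = base (vert (X (Suc (Suc k))) i)"
    have yA: "\<phi> (Suc k) i y \<in> A (Suc k) i" using \<phi>(5)[of "Suc k" i] k i y by auto
    then obtain x where "x \<in> points (vert (X k) i)" "\<phi> (Suc k) i y = f k i x"
      using exact[OF k i, of "\<phi> (Suc k) i y"] b A(1)[of "Suc k" i] k i by auto
    then obtain x' where "x' \<in> A k i" "\<phi> (Suc k) i y = f k i x'"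
      using lift[of k i x] k i yA by auto
    moreover from this have "x' \<in> \<phi> k i ` points (vert (X' k) i)"
      using \<phi>(5)[of k i] k i by simp
    ultimately show "\<exists>x\<in>points (vert (X' k) i). \<phi> (Suc k) i y = f k i (\<phi> k i x)"
      by blast
  next
    fix i y assume i: "i \<in> {1..n}" and y: "y \<in> points (vert (X (Suc m)) i)"
    then obtain x where "x \<in> points (vert (X m) i)" "f m i x = y" using epi by blast
    then have "y \<in> f m i ` A m i" using lift[of m i x] i y A(5)[OF i] by simp
    moreover have "A m i = \<phi> m i ` points (vert (X' m) i)"
      using \<phi>(5)[of m i] i by simp
    ultimately show "\<exists>x\<in>points (vert (X' m) i). f m i (\<phi> m i x) = y"
      by auto
  next
    fix f' assume "exact_seq n m X' f'"
      "\<And>k i x. \<lbrakk>k \<le> m; i \<in> {1..n}; x \<in> points (vert (X' k) i)\<rbrakk>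
        \<Longrightarrow> \<phi> (Suc k) i (f' k i x) = f k i (\<phi> k i x)"
      "leads_to n m (X (Suc m)) (X 0) (mk_ext m X' f') (mk_ext m X f)"
    then show thesis using that[of X' f' \<phi>] X'(2-4) \<phi>(1,2,5) by blast
  qed
qed

section \<open>The subextension generated by lifting the right end\<close>

text \<open>The rule \<open>lift\<close> excludes preimages of the base point: these form a whole
  kernel, whereas every other element has at most one preimage.\<close>

inductive gen :: "nat \<Rightarrow> nat \<Rightarrow> 'a \<Rightarrow> bool" where
  top: "\<lbrakk>i \<in> {1..n}; y \<in> points (vert (X (Suc m)) i)\<rbrakk> \<Longrightarrow> gen (Suc m) i y"
| lift: "\<lbrakk>gen (Suc k) i (f k i x); k \<le> m; i \<in> {1..n}; x \<in> points (vert (X k) i);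
    f k i x \<noteq> base (vert (X (Suc k)) i)\<rbrakk> \<Longrightarrow> gen k i x"
| arr: "\<lbrakk>gen k (Suc i) x; i \<in> {1..<n}\<rbrakk> \<Longrightarrow> gen k i (arr (X k) i x)"

lemma gen_points: "gen k i x \<Longrightarrow> k \<le> Suc m \<and> i \<in> {1..n} \<and> x \<in> points (vert (X k) i)"
proof (induction rule: gen.induct)
  case (arr k i x)
  then show ?case using reps_arr(1)[OF rep[of k] arr(2)] by simp
qed auto

text \<open>A lift is mapped back to the element it was made from, and the maps commute with arrows.
  This gives closure under the maps of the sequence.\<close>

lemma gen_image:
  "gen k i x \<Longrightarrow> k \<le> m \<Longrightarrow> f k i x = base (vert (X (Suc k)) i) \<or> gen (Suc k) i (f k i x)"
proof (induction rule: gen.induct)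
  case (arr k i x)
  have "f k i (arr (X k) i x) = arr (X (Suc k)) i (f k (Suc i) x)"
    using Hom_arr[OF hom[OF arr.prems] arr.hyps(2)] gen_points[OF arr.hyps(1)] by blast
  then show ?case
    using arr.IH[OF arr.prems] gen.arr[OF _ arr.hyps(2), of "Suc k"]
      reps_arr(2)[OF rep[of "Suc k"] arr.hyps(2)] arr.prems by auto
qed auto

text \<open>The image of L is added at \<open>k = 1\<close>, that is in \<open>E_m\<close>, and
  nowhere else: the next map sends it to the base point, so it adds nothing further right.\<close>

definition gensub :: "nat \<Rightarrow> nat \<Rightarrow> 'a set" where
  "gensub k i = (if k = 0 \<or> k = Suc m then points (vert (X k) i)
     else insert (base (vert (X k) i)) {x. gen k i x} \<union>
       (if k = 1 then f 0 i ` points (vert (X 0) i) else {}))"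

lemma gen_subextension:
  assumes m: "m \<ge> 1"
    and g: "\<And>k i. \<lbrakk>k \<in> {1..m}; i \<in> {1..n}\<rbrakk> \<Longrightarrow> inj_on (g k i) (gensub k i)"
  obtains X' f' \<phi> where "exact_seq n m X' f'" "X' 0 = X 0" "X' (Suc m) = X (Suc m)"
    "\<And>k i. \<lbrakk>k \<in> {1..m}; i \<in> {1..n}\<rbrakk> \<Longrightarrow> points (vert (X' k) i) = g k i ` gensub k i"
    "\<And>k. k \<le> Suc m \<Longrightarrow> \<phi> k \<in> Hom n (X' k) (X k)"
    "\<And>k i. \<lbrakk>k \<le> Suc m; i \<in> {1..n}\<rbrakk> \<Longrightarrow> inj_on (\<phi> k i) (points (vert (X' k) i))"
    "\<And>k i. \<lbrakk>k \<le> Suc m; i \<in> {1..n}\<rbrakk> \<Longrightarrow> \<phi> k i ` points (vert (X' k) i) = gensub k i"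
    "\<And>k i x. \<lbrakk>k \<le> m; i \<in> {1..n}; x \<in> points (vert (X' k) i)\<rbrakk>
      \<Longrightarrow> \<phi> (Suc k) i (f' k i x) = f k i (\<phi> k i x)"
    "leads_to n m (X (Suc m)) (X 0) (mk_ext m X' f') (mk_ext m X f)"
proof (rule subextension[of gensub g])
  fix k i assume k: "k \<le> Suc m" and i: "i \<in> {1..n}"
  show "gensub k i \<subseteq> points (vert (X k) i)"
    using gen_points reps_vert(2)[OF rep[OF k] i] HomD(1)[OF hom[of 0] i]
    by (auto simp: gensub_def)
  show "base (vert (X k) i) \<in> gensub k i"
    using reps_vert(2)[OF rep[OF k] i] by (auto simp: gensub_def)
next
  fix k i x assume k: "k \<le> Suc m" and i: "i \<in> {1..<n}" and x: "x \<in> gensub k (Suc i)"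
  note a = reps_arr[OF rep[OF k] i]
  have "arr (X 1) i (f 0 (Suc i) z) \<in> f 0 i ` points (vert (X 0) i)"
    if "z \<in> points (vert (X 0) (Suc i))" for z
    using Hom_arr[OF hom[of 0] i that] reps_arr(1)[OF rep[of 0] i that] by (auto intro: rev_image_eqI)
  then show "arr (X k) i x \<in> gensub k i"
    using x a(1,2) gen.arr[OF _ i] by (auto simp: gensub_def split: if_splits)
next
  fix k i x assume k: "k \<le> m" and i: "i \<in> {1..n}" and x: "x \<in> gensub k i"
  show "f k i x \<in> gensub (Suc k) i"
  proof (cases "k = m")
    case True
    have "x \<in> points (vert (X k) i)"
      using x k gen_points[of k i x] reps_vert(2)[OF rep[of k] i] HomD(1)[OF hom[of 0] i]
      by (auto simp: gensub_def split: if_splits)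
    then show ?thesis using True HomD(1)[OF hom[OF k] i] by (simp add: gensub_def)
  next
    case False
    have "f 1 i (f 0 i z) = base (vert (X (Suc 1)) i)" if "z \<in> points (vert (X 0) i)" for z
      using exact[of 0 i "f 0 i z"] HomD(1)[OF hom[of 0] i] i m that by auto
    then show ?thesis
      using False k x gen_image[of k i x] HomD(2)[OF hom[OF k] i]
      by (auto simp: gensub_def split: if_splits)
  qed
next
  fix k i x assume k: "k \<le> m" and i: "i \<in> {1..n}" and x: "x \<in> points (vert (X k) i)"
    and fx: "f k i x \<in> gensub (Suc k) i"
  show "f k i x \<in> f k i ` gensub k i"
  proof (cases "k = 0 \<or> f k i x = base (vert (X (Suc k)) i)")
    case True
    then show ?thesis
      using x HomD(2)[OF hom[OF k] i] by (auto simp: gensub_def intro!: rev_image_eqI)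
  next
    case False
    \<comment> \<open>As \<open>k\<close> is positive, \<open>Suc k\<close> is not the position
      where the image of L was added, so a non-base member of \<open>gensub (Suc k)\<close> is
      generated; if \<open>Suc k\<close> is the right end, rule \<open>top\<close> applies.\<close>
    then have "gen (Suc k) i (f k i x)"
      using fx k gen.top[OF i] by (auto simp: gensub_def split: if_splits)
    then have "gen k i x" using gen.lift k i x False by blast
    then show ?thesis using k False by (auto simp: gensub_def)
  qed
qed (use g that in \<open>auto simp: gensub_def\<close>)

lemma finite_gen: "k \<le> Suc m \<Longrightarrow> i \<in> {1..n} \<Longrightarrow> finite {x. gen k i x}"
  by (rule finite_subset[OF _ reps_vert(1)[OF rep]]) (use gen_points in auto)

text \<open>Left of N, a generated element is either a lift, and lifts inject into the generated
  elements at \<open>(Suc k, i)\<close>, or the image under an arrow of one at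
  \<open>(k, Suc i)\<close>. Both sources have an exponent smaller by one, so the bound doubles at
  each step; at the right end \<open>D\<close> itself is a bound.\<close>

lemma card_gen_le:
  assumes D: "\<And>i. i \<in> {1..n} \<Longrightarrow> card (points (vert (X (Suc m)) i)) \<le> D"
  shows "k \<le> Suc m \<Longrightarrow> i \<in> {1..n} \<Longrightarrow> card {x. gen k i x} \<le> D * 2 ^ (Suc m - k + (n - i))"
proof (induction "Suc m - k + (n - i)" arbitrary: k i rule: less_induct)
  case less
  show ?case
  proof (cases "k = Suc m")
    case True
    have "card {x. gen k i x} \<le> card (points (vert (X (Suc m)) i))"
      using gen_points True reps_vert(1)[OF rep[of "Suc m"] less(3)] by (intro card_mono) auto
    also have "\<dots> \<le> D * 1" using D[OF less(3)] by simp
    also have "\<dots> \<le> D * 2 ^ (Suc m - k + (n - i))" by (intro mult_le_mono2) simp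
    finally show ?thesis .
  next
    case False
    then have k: "k \<le> m" using less by auto
    define Lft where "Lft = {x \<in> points (vert (X k) i). f k i x \<noteq> base (vert (X (Suc k)) i) \<and> gen (Suc k) i (f k i x)}"
    have inj: "inj_on (f k i) Lft"
      unfolding Lft_def inj_on_def using HomD(3)[OF hom[OF k] less(3)] by blast
    have "card Lft \<le> card {x. gen (Suc k) i x}"
      using card_inj_on_le[OF inj] finite_gen[of "Suc k" i] k less(3) by (auto simp: Lft_def)
    also have "\<dots> \<le> D * 2 ^ (m - k + (n - i))"
      using less(1)[of "Suc k" i] k less(3) by (simp add: Suc_diff_le)
    finally have Lft: "card Lft \<le> D * 2 ^ (m - k + (n - i))" .
    have fin: "finite Lft" unfolding Lft_def using reps_vert(1)[OF rep less(3)] k by simp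
    show ?thesis
    proof (cases "i < n")
      case True
      then have i: "i \<in> {1..<n}" "Suc i \<in> {1..n}" using less by auto
      have "{x. gen k i x} \<subseteq> Lft \<union> arr (X k) i ` {x. gen k (Suc i) x}"
        unfolding Lft_def using False by (auto elim: gen.cases)
      then have "card {x. gen k i x} \<le> card (Lft \<union> arr (X k) i ` {x. gen k (Suc i) x})"
        using fin finite_gen[OF less(2) i(2)] by (intro card_mono) auto
      also have "\<dots> \<le> card Lft + card {x. gen k (Suc i) x}"
        using card_Un_le card_image_le[OF finite_gen[OF less(2) i(2)]]
        by (meson add_left_mono order_trans)
      also have "\<dots> \<le> D * 2 ^ (m - k + (n - i)) + D * 2 ^ (Suc m - k + (n - Suc i))"
        using Lft less(1)[of k "Suc i"] less(2) i True by (intro add_mono) auto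
      also have "\<dots> = D * 2 ^ (Suc m - k + (n - i))"
        using True k by (simp add: Suc_diff_le Suc_diff_Suc)
      finally show ?thesis .
    next
      case ni: False
      have "{x. gen k i x} \<subseteq> Lft"
        unfolding Lft_def using False ni by (auto elim: gen.cases)
      then have "card {x. gen k i x} \<le> card Lft" using fin by (rule card_mono[rotated])
      also have "\<dots> \<le> D * 2 ^ (m - k + (n - i))" by (fact Lft)
      also have "\<dots> \<le> D * 2 ^ (Suc m - k + (n - i))" by (intro mult_le_mono2 power_increasing) auto
      finally show ?thesis .
    qed
  qed
qed

text \<open>The second clause drives the induction. An element that is lifted comes from the
  previous term, so it lies in the kernel of its outgoing map, and its stronger bound becomes the
  weak bound of the lift. The lift itself is outside the kernel, so its second clause is vacuous. An
  arrow lowers \<open>i\<close> by one and thereby earns the stronger bound again.\<close>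

lemma gen_height:
  "gen k i x \<Longrightarrow> k \<le> m \<Longrightarrow> x \<noteq> base (vert (X k) i) \<Longrightarrow>
    i + (m - k) \<le> n \<and> (f k i x = base (vert (X (Suc k)) i) \<longrightarrow> i + (Suc m - k) \<le> n)"
proof (induction rule: gen.induct)
  case (lift k i x)
  show ?case
  proof (cases "k = m")
    case False
    then have k: "k < m" using lift by simp
    then have "f (Suc k) i (f k i x) = base (vert (X (Suc (Suc k))) i)"
      using exact[OF k, of i "f k i x"] lift HomD(1)[OF hom[of k]] by auto
    then show ?thesis using lift k by auto
  qed (use lift in auto)
next
  case (arr k i x)
  have "x \<noteq> base (vert (X k) (Suc i))"
    using arr reps_arr(2)[OF rep[of k] arr(2)] by auto
  then show ?case using arr by auto
qed auto

text \<open>If no arrow of the right end has a kernel, the elements generated by the lifts are again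
  lifts, so nothing has to be lifted a second time.\<close>

lemma gen_kernel:
  assumes inj: "\<And>i x. \<lbrakk>i \<in> {1..<n}; x \<in> points (vert (X (Suc m)) (Suc i));
    arr (X (Suc m)) i x = base (vert (X (Suc m)) i)\<rbrakk> \<Longrightarrow> x = base (vert (X (Suc m)) (Suc i))"
  shows "gen k i x \<Longrightarrow> k \<le> m \<Longrightarrow> k < m \<or> f k i x = base (vert (X (Suc k)) i) \<Longrightarrow>
    x = base (vert (X k) i)"
proof (induction rule: gen.induct)
  case (lift k i x)
  then have k: "k < m" by auto
  then have "f (Suc k) i (f k i x) = base (vert (X (Suc (Suc k))) i)"
    using exact[OF k, of i "f k i x"] lift HomD(1)[OF hom[of k]] by auto
  then show ?case using lift k by auto
next
  case (arr k i x)
  have b: "arr (X k) i (base (vert (X k) (Suc i))) = base (vert (X k) i)"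
    using reps_arr(2)[OF rep[of k] arr(2)] arr by auto
  show ?case
  proof (cases "k < m")
    case True
    then show ?thesis using arr.IH b by simp
  next
    case False
    then have k: "k = m" and fm: "f m i (arr (X m) i x) = base (vert (X (Suc m)) i)"
      using arr.prems by auto
    have x: "x \<in> points (vert (X m) (Suc i))" and i: "Suc i \<in> {1..n}"
      using gen_points[OF arr(1)] k by auto
    have "arr (X (Suc m)) i (f m (Suc i) x) = base (vert (X (Suc m)) i)"
      using Hom_arr[OF hom[of m] arr(2) x] fm by simp
    then have "f m (Suc i) x = base (vert (X (Suc m)) (Suc i))"
      using inj[OF arr(2)] HomD(1)[OF hom[of m] i x] by simp
    then show ?thesis using arr.IH k b by simp
  qed
qed auto

end

section \<open>Equivalence classes of extensions\<close>

lemma equiv_ext_equiv: "equiv (extensions n m N L) (ext_equiv n m N L)"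
  by (rule equivI)
    (auto simp: ext_equiv_def refl_on_def sym_def trans_def
      intro: equivclp_sym equivclp_trans)

lemma sym_ext_equiv: "sym (ext_equiv n m N L)" and trans_ext_equiv: "trans (ext_equiv n m N L)"
  using equiv_ext_equiv[of n m N L] by (auto elim: equivE)

lemma leads_to_ext_equiv: "leads_to n m N L e e' \<Longrightarrow> (e, e') \<in> ext_equiv n m N L"
  using r_into_equivclp[of "leads_to n m N L" e e']
  by (auto simp: ext_equiv_def) (auto simp: leads_to_def)

section \<open>Finitely many representatives for the classes of extensions\<close>

lemma finite_quotient_representatives:
  assumes "equiv A r" "finite R" "\<And>x. x \<in> A \<Longrightarrow> \<exists>y\<in>R. (x, y) \<in> r"
  shows "finite (A // r)"
proof (rule finite_subset)
  show "A // r \<subseteq> (\<lambda>y. r `` {y}) ` R"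
    using assms(3) equiv_class_eq[OF assms(1)] by (force elim!: quotientE)
qed (use assms in simp)

text \<open>Extensionality pins down both families outside the vertices and every map outside its
  source, so only finitely many choices of subsets, base points and values remain.\<close>

lemma finite_reps_within:
  assumes "finite F"
  shows "finite {M \<in> reps n. \<forall>i\<in>{1..n}. points (vert M i) \<subseteq> F}"
proof -
  define V :: "'a pointed set" where "V = (\<lambda>(P, b). \<lparr>points = P, base = b\<rparr>) ` (Pow F \<times> F)"
  have V: "W \<in> V" if "points W \<subseteq> F" "base W \<in> points W" for W
    using that unfolding V_def by (cases W) auto
  define H where "H = (\<Pi>\<^sub>E i\<in>{1..<n}. \<Union>W\<in>V. \<Union>W'\<in>V. points W \<rightarrow>\<^sub>E points W')"
  have "finite V" unfolding V_def using assms by simp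
  moreover have "finite (points W)" if "W \<in> V" for W
    using that finite_subset[OF _ assms] unfolding V_def by auto
  ultimately have "finite ((\<lambda>(v, a). \<lparr>vert = v, arr = a\<rparr>) ` (({1..n} \<rightarrow>\<^sub>E V) \<times> H))"
    unfolding H_def by (intro finite_imageI finite_cartesian_product finite_PiE) (auto intro!: finite_PiE)
  moreover have "M \<in> (\<lambda>(v, a). \<lparr>vert = v, arr = a\<rparr>) ` (({1..n} \<rightarrow>\<^sub>E V) \<times> H)"
    if M: "M \<in> reps n" "\<forall>i\<in>{1..n}. points (vert M i) \<subseteq> F" for M
  proof -
    have v: "vert M i \<in> V" if "i \<in> {1..n}" for i
      using V reps_vert(2)[OF M(1) that] M(2) that by blast
    moreover have "arr M i \<in> points (vert M (Suc i)) \<rightarrow>\<^sub>E points (vert M i)" if "i \<in> {1..<n}" for i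
      using M(1) that unfolding reps_def f1_linear_def by (auto simp: PiE_def Pi_def)
    then have "arr M i \<in> (\<Union>W\<in>V. \<Union>W'\<in>V. points W \<rightarrow>\<^sub>E points W')" if "i \<in> {1..<n}" for i
      using that v[of i] v[of "Suc i"] by auto
    ultimately have "(vert M, arr M) \<in> ({1..n} \<rightarrow>\<^sub>E V) \<times> H"
      using M(1) unfolding H_def reps_def by (auto simp: PiE_def)
    then show ?thesis by (intro rev_image_eqI) auto
  qed
  ultimately show ?thesis by (elim finite_subset[rotated]) blast
qed

text \<open>The order of quantifiers is the point: \<open>F\<close> depends on \<open>n\<close>,
  \<open>m\<close>, L and N, but not on the extension \<open>e\<close>.\<close>

lemma bounded_representative:
  fixes L N :: "'a::infinite rep"
  assumes L: "L \<in> reps n" and N: "N \<in> reps n" and m: "m \<ge> 1"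
  obtains F where "finite F" "\<And>e. e \<in> extensions n m N L \<Longrightarrow>
    \<exists>X f. exact_seq n m X f \<and> X 0 = L \<and> X (Suc m) = N \<and>
      (\<forall>k\<in>{1..m}. \<forall>i\<in>{1..n}. points (vert (X k) i) \<subseteq> F) \<and> leads_to n m N L (mk_ext m X f) e"
proof -
  define D where "D = (\<Sum>i\<in>{1..n}. card (points (vert N i)))"
  define C where "C = (\<Sum>i\<in>{1..n}. card (points (vert L i)))"
  \<comment> \<open>The three summands make room for the base point, for the generated elements (the
    exponent \<open>m + n\<close> covers every position and vertex), and for the image of L.\<close>
  obtain F :: "'a set" where F: "finite F" "card F = 1 + D * 2 ^ (m + n) + C"
    using infinite_arbitrarily_large[OF infinite_UNIV] by blast
  have "\<exists>X f. exact_seq n m X f \<and> X 0 = L \<and> X (Suc m) = N \<and>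
      (\<forall>k\<in>{1..m}. \<forall>i\<in>{1..n}. points (vert (X k) i) \<subseteq> F) \<and> leads_to n m N L (mk_ext m X f) e"
    if e_ext: "e \<in> extensions n m N L" for e
  proof -
    obtain X f where e: "e = mk_ext m X f" and ex: "exact_seq n m X f" and LN: "X 0 = L" "X (Suc m) = N"
      using extensionsE[OF e_ext L N] by blast
    interpret exact_seq n m X f by (fact ex)
    have "card (gensub k i) \<le> card F \<and> finite (gensub k i)" if k: "k \<in> {1..m}" and i: "i \<in> {1..n}" for k i
    proof
      have fin: "finite {x. gen k i x}" using finite_gen[of k i] k i by simp
      have cN: "card (points (vert (X (Suc m)) j)) \<le> D" if "j \<in> {1..n}" for j
        unfolding LN D_def using that by (intro member_le_sum) auto
      have "card {x. gen k i x} \<le> D * 2 ^ (Suc m - k + (n - i))"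
        using card_gen_le[OF cN, of k i] k i by simp
      also have "\<dots> \<le> D * 2 ^ (m + n)"
        using k by (intro mult_le_mono2 power_increasing) auto
      finally have c1: "card {x. gen k i x} \<le> D * 2 ^ (m + n)" .
      have "card (f 0 i ` points (vert (X 0) i)) \<le> card (points (vert L i))"
        using reps_vert(1)[OF L i] LN by (simp add: card_image_le)
      also have "\<dots> \<le> C"
        unfolding C_def using i by (intro member_le_sum) auto
      finally have c2: "card (f 0 i ` points (vert (X 0) i)) \<le> C" .
      have finL: "finite (f 0 i ` points (vert (X 0) i))" using reps_vert(1)[OF L i] LN by simp
      let ?S = "insert (base (vert (X k) i)) {x. gen k i x}"
      have sub: "gensub k i \<subseteq> ?S \<union> f 0 i ` points (vert (X 0) i)"
        using k by (auto simp: gensub_def)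
      show "finite (gensub k i)" using finite_subset[OF sub] fin finL by blast
      have "card (gensub k i) \<le> card (?S \<union> f 0 i ` points (vert (X 0) i))"
        using sub fin finL by (intro card_mono) auto
      also have "\<dots> \<le> card ?S + card (f 0 i ` points (vert (X 0) i))" by (rule card_Un_le)
      also have "\<dots> \<le> Suc (card {x. gen k i x}) + C"
        using c2 card_insert_le_m1[of "Suc (card {x. gen k i x})" "{x. gen k i x}"]
        by (intro add_mono) auto
      also have "\<dots> \<le> card F" using c1 F(2) by simp
      finally show "card (gensub k i) \<le> card F" .
    qed
    then have ex_inj: "\<exists>h. inj_on h (gensub k i) \<and> h ` gensub k i \<subseteq> F"
      if "k \<in> {1..m}" "i \<in> {1..n}" for k i
      using inj_on_iff_card_le[of "gensub k i" F] F(1) that by simp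
    define g where "g k i = (SOME h. inj_on h (gensub k i) \<and> h ` gensub k i \<subseteq> F)" for k i
    have g: "inj_on (g k i) (gensub k i)" "g k i ` gensub k i \<subseteq> F"
      if "k \<in> {1..m}" "i \<in> {1..n}" for k i
      using someI_ex[OF ex_inj[OF that]] by (simp_all add: g_def)
    obtain X' f' where "exact_seq n m X' f'" "X' 0 = X 0" "X' (Suc m) = X (Suc m)"
      "\<And>k i. \<lbrakk>k \<in> {1..m}; i \<in> {1..n}\<rbrakk> \<Longrightarrow> points (vert (X' k) i) = g k i ` gensub k i"
      "leads_to n m (X (Suc m)) (X 0) (mk_ext m X' f') (mk_ext m X f)"
    proof (rule gen_subextension[OF m g(1)], goal_cases)
      case (3 X' f' \<phi>)
      show ?case by (rule 3(1)[OF 3(2-5,10)])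
    qed
    then show ?thesis using LN e g(2) by (intro exI[of _ X'] exI[of _ f']) simp
  qed
  then show thesis using that F(1) by blast
qed

lemma finite_Ext_quotient:
  fixes L N :: "'a::infinite rep"
  assumes L: "L \<in> reps n" and N: "N \<in> reps n" and m: "m \<ge> 1"
  shows "finite (extensions n m N L // ext_equiv n m N L)"
proof -
  obtain F where F: "finite F" "\<And>e. e \<in> extensions n m N L \<Longrightarrow>
    \<exists>X f. exact_seq n m X f \<and> X 0 = L \<and> X (Suc m) = N \<and>
      (\<forall>k\<in>{1..m}. \<forall>i\<in>{1..n}. points (vert (X k) i) \<subseteq> F) \<and> leads_to n m N L (mk_ext m X f) e"
    using bounded_representative[OF assms] by blast
  \<comment> \<open>L and N need not live inside \<open>F\<close>, but they are the source of the
    first and the target of the last map.\<close>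
  define S where "S = insert L (insert N {M \<in> reps n. \<forall>i\<in>{1..n}. points (vert M i) \<subseteq> F})"
  have S: "finite S" "S \<subseteq> reps n" unfolding S_def using finite_reps_within[OF F(1)] L N by auto
  define H where "H = (\<Union>M\<in>S. \<Union>M'\<in>S. Hom n M M')"
  have H: "finite H" unfolding H_def using S finite_Hom by blast
  define R where "R = {Es. set Es \<subseteq> S \<and> length Es = m} \<times> {fs. set fs \<subseteq> H \<and> length fs = Suc m}"
  show ?thesis
  proof (rule finite_quotient_representatives[OF equiv_ext_equiv])
    show "finite R" unfolding R_def using finite_lists_length_eq[OF S(1)] finite_lists_length_eq[OF H] by simp
    fix e assume e: "e \<in> extensions n m N L"
    obtain X f where ex: "exact_seq n m X f" and X: "X 0 = L" "X (Suc m) = N"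
      "\<forall>k\<in>{1..m}. \<forall>i\<in>{1..n}. points (vert (X k) i) \<subseteq> F" "leads_to n m N L (mk_ext m X f) e"
      using F(2)[OF e] by blast
    interpret exact_seq n m X f by (fact ex)
    have XS: "X k \<in> S" if k: "k \<le> Suc m" for k
    proof -
      consider "k = 0" | "k = Suc m" | "k \<in> {1..m}" using k by fastforce
      then show ?thesis using X rep[OF k] by cases (auto simp: S_def)
    qed
    have "f k \<in> H" if "k \<le> m" for k
      unfolding H_def using hom[OF that] XS[of k] XS[of "Suc k"] that by auto
    then have "mk_ext m X f \<in> R"
      unfolding R_def mk_ext_def using XS by (auto simp del: upt_Suc)
    moreover have "(e, mk_ext m X f) \<in> ext_equiv n m N L"
      using leads_to_ext_equiv[OF X(4)] by (rule symD[OF sym_ext_equiv])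
    ultimately show "\<exists>y\<in>R. (e, y) \<in> ext_equiv n m N L" by blast
  qed
qed

section \<open>The trivial extension\<close>

lemma zero_rep_reps: "zero_rep n \<in> reps n"
  by (rule repsI) (auto simp: zero_rep_def f1_space_def intro!: f1_linearI)

lemma exact_seq_long_trivial:
  assumes L: "L \<in> reps n" and N: "N \<in> reps n" and m: "m \<ge> 2"
  obtains T t where "exact_seq n m T t" "T 0 = L" "T 1 = L" "T m = N" "T (Suc m) = N"
    "trivial_ext n m N L = mk_ext m T t" "t 0 = id_mor n L" "t m = id_mor n N"
    "\<And>k. \<lbrakk>1 \<le> k; k < m\<rbrakk> \<Longrightarrow> t k = zero_mor n (T k) (T (Suc k))"
proof -
  \<comment> \<open>The sequence is L, L, 0, ..., 0, N, N; for \<open>m = 2\<close> there is no zero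
    term. Positions 1 and \<open>m\<close> differ because \<open>m\<close> is at least 2.\<close>
  define T where "T k = (if k \<le> 1 then L else if k < m then zero_rep n else N)" for k
  define t where "t k = (if k = 0 then id_mor n L else if k = m then id_mor n N
    else zero_mor n (T k) (T (Suc k)))" for k
  have T: "T k \<in> reps n" for k unfolding T_def using L N zero_rep_reps by auto
  have T_eq: "T 0 = L" "T 1 = L" "T m = N" "T (Suc m) = N"
    unfolding T_def using m by auto
  have t_eq: "t 0 = id_mor n L" "t m = id_mor n N" unfolding t_def using m by auto
  have t_zero: "t k = zero_mor n (T k) (T (Suc k))" if "1 \<le> k" "k < m" for k
    unfolding t_def using that by auto
  have t_zero_apply: "t k i x = base (vert (T (Suc k)) i)"
    if "1 \<le> k" "k < m" "i \<in> {1..n}" "x \<in> points (vert (T k) i)" for k i x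
    using that(3,4) unfolding t_zero[OF that(1,2)] zero_mor_def by simp
  have ex: "exact_seq n m T t"
  proof
    show "T k \<in> reps n" for k by (fact T)
    show "t k \<in> Hom n (T k) (T (Suc k))" for k
      using id_mor_Hom[OF L] id_mor_Hom[OF N] zero_mor_Hom[OF T T] T_eq by (auto simp: t_def)
  next
    fix i x assume "i \<in> {1..n}" "x \<in> points (vert (T 0) i)" "t 0 i x = base (vert (T (Suc 0)) i)"
    then show "x = base (vert (T 0) i)" using T_eq t_eq by (simp add: id_mor_apply)
  next
    fix i y assume "i \<in> {1..n}" "y \<in> points (vert (T (Suc m)) i)"
    then show "\<exists>x\<in>points (vert (T m) i). t m i x = y"
      using T_eq t_eq by (auto simp: id_mor_apply)
  next
    fix k i y assume k: "k < m" and i: "i \<in> {1..n}" and y: "y \<in> points (vert (T (Suc k)) i)"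
    \<comment> \<open>Exactness is checked at L (all of it is hit and is killed by a zero map), at a
      zero term, and at N (only the base point is hit, and the identity follows).\<close>
    consider "k = 0" | "1 \<le> k" "Suc k < m" | "1 \<le> k" "Suc k = m" using k by linarith
    then show "t (Suc k) i y = base (vert (T (Suc (Suc k))) i) \<longleftrightarrow>
      (\<exists>x\<in>points (vert (T k) i). y = t k i x)"
    proof cases
      case 1
      then have "t (Suc k) i y = base (vert (T (Suc (Suc k))) i)"
        using t_zero_apply[of "Suc k" i y] m i y by simp
      moreover have "t k i y = y" "y \<in> points (vert (T k) i)"
        using 1 y i T_eq t_eq by (simp_all add: id_mor_apply)
      ultimately show ?thesis by metis
    next
      case 2
      have b: "base (vert (T k) i) \<in> points (vert (T k) i)" using reps_vert(2)[OF T i] .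
      have "y = base (vert (T (Suc k)) i)" using y i 2 by (simp add: T_def zero_rep_def)
      then show ?thesis
        using 2 i y b t_zero_apply[of "Suc k" i y] t_zero_apply[OF 2(1) k i b]
        by (auto intro!: bexI[of _ "base (vert (T k) i)"])
    next
      case 3
      have b: "base (vert (T k) i) \<in> points (vert (T k) i)" using reps_vert(2)[OF T i] .
      have "t (Suc k) i y = y" using 3 y i T_eq t_eq by (simp add: id_mor_apply)
      then show ?thesis
        using 3 T_eq b t_zero_apply[OF 3(1) k i] by auto
    qed
  qed
  define Es where "Es = L # replicate (m - 2) (zero_rep n) @ [N]"
  have len: "length Es = m" using m by (simp add: Es_def)
  have Es_nth: "Es ! k = T (Suc k)" if "k < m" for k
    using that m by (auto simp: Es_def T_def nth_Cons' nth_append)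
  have "trivial_ext n m N L =
      (Es, id_mor n L # map (\<lambda>k. zero_mor n (Es ! k) (Es ! (k + 1))) [0..<m - 1] @ [id_mor n N])"
    unfolding trivial_ext_def Es_def Let_def using m by simp
  also have "\<dots> = mk_ext m T t"
    unfolding mk_ext_def prod.inject
  proof
    show "Es = map T [1..<Suc m]"
      by (rule nth_equalityI) (auto simp: len Es_nth simp del: upt_Suc)
    show "id_mor n L # map (\<lambda>k. zero_mor n (Es ! k) (Es ! (k + 1))) [0..<m - 1] @ [id_mor n N] =
        map t [0..<Suc m]" (is "?l = _")
    proof (rule nth_equalityI)
      show "length ?l = length (map t [0..<Suc m])" using m by simp
      fix k assume "k < length ?l"
      then have k: "k \<le> m" using m by simp
      consider "k = 0" | "1 \<le> k" "k < m" | "k = m" using k by linarith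
      then show "?l ! k = map t [0..<Suc m] ! k"
        using k m t_eq by cases
          (auto simp: nth_Cons' nth_append t_zero Es_nth simp del: upt_Suc)
    qed
  qed
  finally show thesis using that[OF ex T_eq] t_eq t_zero by blast
qed

text \<open>An infinite set absorbs a disjoint copy of itself, so the choice in
  \<open>sum_emb\<close> does pick an injection.\<close>

lemma inj_sum_emb: "inj (sum_emb :: 'a::infinite + 'a \<Rightarrow> 'a)"
proof -
  have "(card_of ((UNIV::'a set) <+> (UNIV::'a set)), card_of (UNIV::'a set)) \<in> ordLeq"
    using card_of_Plus_infinite1[OF infinite_UNIV ordLeq_refl[OF card_of_Card_order]]
      ordIso_imp_ordLeq by blast
  then have "\<exists>f::'a + 'a \<Rightarrow> 'a. inj f"
    unfolding card_of_ordLeq[symmetric] by auto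
  then show ?thesis unfolding sum_emb_def by (rule someI_ex)
qed

lemma inv_sum_emb [simp]: "inv sum_emb (sum_emb z) = (z :: 'a::infinite + 'a)"
  by (rule inv_f_f[OF inj_sum_emb])

lemma sum_emb_eq [simp]: "sum_emb z = sum_emb w \<longleftrightarrow> z = (w :: 'a::infinite + 'a)"
  by (rule inj_eq[OF inj_sum_emb])

lemma wedge_eq [simp]:
  "wedge_inl x = wedge_inl x' \<longleftrightarrow> x = x'"
  "wedge_inr V W y = wedge_inr V W y' \<longleftrightarrow> y = y'"
  "wedge_inl x = wedge_inr V W y \<longleftrightarrow> x = base V \<and> y = base W"
  "wedge_inr V W y = wedge_inl x \<longleftrightarrow> x = base V \<and> y = base W"
  unfolding wedge_inl_def wedge_inr_def by auto

lemma exact_seq_dsum: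
  fixes L N :: "'a::infinite rep"
  assumes L: "L \<in> reps n" and N: "N \<in> reps n"
  shows "exact_seq n 1 (\<lambda>k. [L, dsum n L N, N] ! k) (\<lambda>k. [dsum_incl n L, dsum_proj n L N] ! k)"
proof -
  let ?D = "dsum n L N"
  have vert: "vert ?D i = wedge (vert L i) (vert N i)" if "i \<in> {1..n}" for i
    using that by (simp add: dsum_def)
  have pts: "points (vert ?D i) = wedge_inl ` points (vert L i) \<union>
      wedge_inr (vert L i) (vert N i) ` points (vert N i)"
    and bse: "base (vert ?D i) = wedge_inl (base (vert L i))" if "i \<in> {1..n}" for i
    using vert[OF that] by (simp_all add: wedge_def)
  have arr_l: "arr ?D i (wedge_inl x) = wedge_inl (arr L i x)"
    if "i \<in> {1..<n}" "x \<in> points (vert L (Suc i))" for i x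
    using that by (simp add: dsum_def wedge_def) (simp add: wedge_inl_def)
  have arr_r: "arr ?D i (wedge_inr (vert L (Suc i)) (vert N (Suc i)) y) =
      wedge_inr (vert L i) (vert N i) (arr N i y)"
    if "i \<in> {1..<n}" "y \<in> points (vert N (Suc i))" for i y
    \<comment> \<open>The base point of the right summand is stored as the left one, so for it the
      left branch of the case distinction is taken; hence the arrows of both summands must preserve
      base points.\<close>
    using that reps_arr(2)[OF L that(1)] reps_arr(2)[OF N that(1)]
    by (auto simp add: dsum_def wedge_def) (auto simp: wedge_inr_def wedge_inl_def)
  have D: "?D \<in> reps n"
  proof (rule repsI)
    fix i assume i: "i \<in> {1..n}"
    then show "f1_space (vert ?D i)"
      using reps_vert[OF L i] reps_vert[OF N i] by (auto simp: f1_space_def pts[OF i] bse[OF i])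
  next
    fix i assume i: "i \<in> {1..<n}"
    then have i': "i \<in> {1..n}" "Suc i \<in> {1..n}" by auto
    note aL = reps_arr[OF L i] and aN = reps_arr[OF N i]
    show "arr ?D i \<in> f1_linear (vert ?D (Suc i)) (vert ?D i)"
    proof (rule f1_linearI)
      show "arr ?D i \<in> extensional (points (vert ?D (Suc i)))"
        using i i' by (simp add: dsum_def)
      show "arr ?D i (base (vert ?D (Suc i))) = base (vert ?D i)"
        using arr_l[OF i reps_vert(2)[OF L i'(2)]] aL(2) bse[OF i'(1)] bse[OF i'(2)] by simp
      show "arr ?D i x \<in> points (vert ?D i)" if "x \<in> points (vert ?D (Suc i))" for x
        using that aL(1) aN(1) arr_l[OF i] arr_r[OF i] by (auto simp: pts[OF i'(1)] pts[OF i'(2)])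
      show "x = y" if "x \<in> points (vert ?D (Suc i))" "y \<in> points (vert ?D (Suc i))"
        "arr ?D i x = arr ?D i y" "arr ?D i x \<noteq> base (vert ?D i)" for x y
        using that aL(3) aN(3) arr_l[OF i] arr_r[OF i] by (auto simp: pts[OF i'(1)] pts[OF i'(2)] bse[OF i'(1)])
    qed
  qed (auto simp: dsum_def)
  have incl: "dsum_incl n L \<in> Hom n L ?D"
    unfolding dsum_incl_def by (rule restrict_Hom) (auto simp: pts bse arr_l L)
  have proj_l: "dsum_proj n L N i (wedge_inl x) = base (vert N i)"
    if "i \<in> {1..n}" "x \<in> points (vert L i)" for i x
    using that by (simp add: dsum_proj_def wedge_def) (simp add: wedge_inl_def)
  have proj_r: "dsum_proj n L N i (wedge_inr (vert L i) (vert N i) y) = y"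
    if "i \<in> {1..n}" "y \<in> points (vert N i)" for i y
    using that by (simp add: dsum_proj_def wedge_def) (auto simp: wedge_inr_def)
  have proj: "dsum_proj n L N \<in> Hom n ?D N"
  proof (rule HomI)
    fix i assume i: "i \<in> {1..n}"
    show "dsum_proj n L N i \<in> f1_linear (vert ?D i) (vert N i)"
    proof (rule f1_linearI)
      show "dsum_proj n L N i \<in> extensional (points (vert ?D i))"
        using i by (simp add: dsum_proj_def vert)
      show "dsum_proj n L N i (base (vert ?D i)) = base (vert N i)"
        using proj_l[OF i reps_vert(2)[OF L i]] bse[OF i] by simp
      show "dsum_proj n L N i x \<in> points (vert N i)" if "x \<in> points (vert ?D i)" for x
        using that proj_l[OF i] proj_r[OF i] reps_vert(2)[OF N i] by (auto simp: pts[OF i])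
      show "x = y" if "x \<in> points (vert ?D i)" "y \<in> points (vert ?D i)"
        "dsum_proj n L N i x = dsum_proj n L N i y" "dsum_proj n L N i x \<noteq> base (vert N i)" for x y
        using that proj_l[OF i] proj_r[OF i] by (auto simp: pts[OF i])
    qed
  next
    fix i x assume i: "i \<in> {1..<n}" and x: "x \<in> points (vert ?D (Suc i))"
    then have i': "i \<in> {1..n}" "Suc i \<in> {1..n}" by auto
    show "dsum_proj n L N i (arr ?D i x) = arr N i (dsum_proj n L N (Suc i) x)"
      using x reps_arr(1,2)[OF L i] reps_arr(1,2)[OF N i] arr_l[OF i] arr_r[OF i]
        proj_l[OF i'(1)] proj_r[OF i'(1)] proj_l[OF i'(2)] proj_r[OF i'(2)]
      by (auto simp: pts[OF i'(2)])
  qed (simp add: dsum_proj_def)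
  have incl_apply: "dsum_incl n L i x = wedge_inl x" if "i \<in> {1..n}" "x \<in> points (vert L i)" for i x
    using that by (simp add: dsum_incl_def)
  show ?thesis
  proof
    fix k :: nat assume "k \<le> Suc 1"
    then show "[L, ?D, N] ! k \<in> reps n" using L N D by (auto simp: le_Suc_eq)
  next
    fix k :: nat assume "k \<le> 1"
    then show "[dsum_incl n L, dsum_proj n L N] ! k \<in> Hom n ([L, ?D, N] ! k) ([L, ?D, N] ! Suc k)"
      using incl proj by (auto simp: le_Suc_eq)
  next
    fix i x assume "i \<in> {1..n}" "x \<in> points (vert ([L, ?D, N] ! 0) i)"
      "([dsum_incl n L, dsum_proj n L N] ! 0) i x = base (vert ([L, ?D, N] ! Suc 0) i)"
    then show "x = base (vert ([L, ?D, N] ! 0) i)" using incl_apply bse by simp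
  next
    fix i y assume "i \<in> {1..n}" "y \<in> points (vert ([L, ?D, N] ! Suc 1) i)"
    then show "\<exists>x\<in>points (vert ([L, ?D, N] ! 1) i). ([dsum_incl n L, dsum_proj n L N] ! 1) i x = y"
      using pts[of i] proj_r[of i] by (auto simp: bex_Un)
  next
    fix k :: nat and i y
    assume k: "k < 1" and i: "i \<in> {1..n}" and y: "y \<in> points (vert ([L, ?D, N] ! Suc k) i)"
    have "dsum_proj n L N i y = base (vert N i) \<longleftrightarrow> (\<exists>x\<in>points (vert L i). y = wedge_inl x)"
      using y k proj_l[OF i] proj_r[OF i] reps_vert(2)[OF L i] by (auto simp: pts[OF i])
    then show "([dsum_incl n L, dsum_proj n L N] ! Suc k) i y = base (vert ([L, ?D, N] ! Suc (Suc k)) i)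
      \<longleftrightarrow> (\<exists>x\<in>points (vert ([L, ?D, N] ! k) i). y = ([dsum_incl n L, dsum_proj n L N] ! k) i x)"
      using k incl_apply[OF i] by simp
  qed
qed

lemma trivial_ext_in_extensions:
  fixes L N :: "'a::infinite rep"
  assumes L: "L \<in> reps n" and N: "N \<in> reps n" and m: "m \<ge> 1"
  shows "trivial_ext n m N L \<in> extensions n m N L"
proof (cases "m = 1")
  case True
  let ?X = "\<lambda>k. [L, dsum n L N, N] ! k" and ?f = "\<lambda>k. [dsum_incl n L, dsum_proj n L N] ! k"
  have "mk_ext 1 ?X ?f \<in> extensions n 1 (?X (Suc 1)) (?X 0)"
    using mk_ext_in_extensions_iff[of ?X n 1 ?f] exact_seq_dsum[OF L N] L N by simp
  moreover have "mk_ext 1 ?X ?f = trivial_ext n 1 N L"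
    by (simp add: mk_ext_def trivial_ext_def)
  ultimately show ?thesis using True by simp
next
  case False
  then obtain T t where "exact_seq n m T t" "T 0 = L" "T (Suc m) = N" "trivial_ext n m N L = mk_ext m T t"
    using exact_seq_long_trivial[OF L N, of m] m by (metis One_nat_def Suc_1 Suc_leI le_neq_implies_less)
  then show ?thesis using mk_ext_in_extensions_iff[of T n m t] L N by simp
qed

section \<open>Comparison with the trivial extension\<close>

context exact_seq
begin

text \<open>A trivial kernel adds to injectivity off the kernel the one point that was
  missing.\<close>

lemma inj_first: "i \<in> {1..n} \<Longrightarrow> inj_on (f 0 i) (points (vert (X 0) i))"
  unfolding inj_on_def using HomD(3)[OF hom[of 0]] mono[of i] by (metis le0)

end

text \<open>If the map leaving \<open>E_m\<close> is zero, exactness makes L fill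
  \<open>E_m\<close>, so \<open>f 0\<close> is invertible. Its inverse starts the comparison and the
  map \<open>E_1\<close> to N ends it, with zero morphisms in between.\<close>

lemma leads_to_trivial:
  fixes X :: "nat \<Rightarrow> 'a::infinite rep"
  assumes X: "exact_seq n m X f" and m: "m \<ge> 2"
    and zero: "\<And>i x. \<lbrakk>i \<in> {1..n}; x \<in> points (vert (X 1) i)\<rbrakk> \<Longrightarrow> f 1 i x = base (vert (X 2) i)"
  shows "leads_to n m (X (Suc m)) (X 0) (mk_ext m X f) (trivial_ext n m (X (Suc m)) (X 0))"
proof -
  interpret exact_seq n m X f by (fact X)
  have LN: "X 0 \<in> reps n" "X (Suc m) \<in> reps n" and X1: "X 1 \<in> reps n" using rep m by auto
  obtain T t where ex: "exact_seq n m T t"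
    and T: "T 0 = X 0" "T 1 = X 0" "T m = X (Suc m)" "T (Suc m) = X (Suc m)"
    and triv: "trivial_ext n m (X (Suc m)) (X 0) = mk_ext m T t"
    and t: "t 0 = id_mor n (X 0)" "t m = id_mor n (X (Suc m))"
      "\<And>k. \<lbrakk>1 \<le> k; k < m\<rbrakk> \<Longrightarrow> t k = zero_mor n (T k) (T (Suc k))"
    using exact_seq_long_trivial[OF LN m] by metis
  interpret T: exact_seq n m T t by (fact ex)
  define h where "h i = inv_into (points (vert (X 0) i)) (f 0 i)" for i
  have h: "h i (f 0 i x) = x" if "i \<in> {1..n}" "x \<in> points (vert (X 0) i)" for i x
    using inj_first that by (simp add: h_def)
  have f0: "\<exists>z\<in>points (vert (X 0) i). x = f 0 i z"
    if "i \<in> {1..n}" "x \<in> points (vert (X 1) i)" for i x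
    using exact[of 0 i x] m zero that by (simp add: numeral_2_eq_2)
  define r where "r = (\<lambda>i\<in>{1..n}. \<lambda>x\<in>points (vert (X 1) i). h i x)"
  have r: "r i (f 0 i x) = x" if "i \<in> {1..n}" "x \<in> points (vert (X 0) i)" for i x
    using h that HomD(1)[OF hom[of 0]] by (simp add: r_def)
  have r_hom: "r \<in> Hom n (X 1) (X 0)"
    unfolding r_def
  proof (rule restrict_Hom[OF _ _ _ _ X1])
    fix i x assume i: "i \<in> {1..n}" and "x \<in> points (vert (X 1) i)"
    then show "h i x \<in> points (vert (X 0) i)" using f0 h by fastforce
  next
    fix i assume i: "i \<in> {1..n}"
    then show "h i (base (vert (X 1) i)) = base (vert (X 0) i)"
      using h[OF i reps_vert(2)[OF LN(1) i]] HomD(2)[OF hom[of 0] i] by simp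
  next
    fix i x y assume i: "i \<in> {1..n}" and "x \<in> points (vert (X 1) i)" "y \<in> points (vert (X 1) i)"
      "h i x = h i y"
    then show "x = y" using f0[OF i, of x] f0[OF i, of y] h[OF i] by auto
  next
    fix i x assume i: "i \<in> {1..<n}" and x: "x \<in> points (vert (X 1) (Suc i))"
    then have i': "i \<in> {1..n}" "Suc i \<in> {1..n}" by auto
    obtain z where z: "z \<in> points (vert (X 0) (Suc i))" "x = f 0 (Suc i) z"
      using f0[OF i'(2) x] by blast
    then have "arr (X 1) i x = f 0 i (arr (X 0) i z)" using Hom_arr[OF hom[of 0] i z(1)] by simp
    then show "h i (arr (X 1) i x) = arr (X 0) i (h (Suc i) x)"
      using z h[OF i'(2) z(1)] h[OF i'(1) reps_arr(1)[OF LN(1) i z(1)]] by simp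
  qed
  \<comment> \<open>At position \<open>m\<close> the target term of the trivial extension is N
    itself, so the last map of the sequence serves as the comparison.\<close>
  define \<phi> where "\<phi> k = (if k = 0 then id_mor n (X 0) else if k = 1 then r else if k = m then f m
    else if k = Suc m then id_mor n (X (Suc m)) else zero_mor n (X k) (T k))" for k
  have \<phi>: "\<phi> 0 = id_mor n (X 0)" "\<phi> 1 = r" "\<phi> m = f m" "\<phi> (Suc m) = id_mor n (X (Suc m))"
    "\<And>k. \<lbrakk>1 < k; k < m\<rbrakk> \<Longrightarrow> \<phi> k = zero_mor n (X k) (T k)"
    using m by (auto simp: \<phi>_def)
  have \<phi>_hom: "\<phi> k \<in> Hom n (X k) (T k)" if k: "k \<le> Suc m" for k
  proof -
    consider "k = 0" | "k = 1" | "1 < k" "k < m" | "k = m" | "k = Suc m" using k by linarith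
    then show ?thesis
      by cases (use \<phi> T r_hom hom[of m] id_mor_Hom LN zero_mor_Hom[OF rep T.rep] in auto)
  qed
  have "leads_to n m (X (Suc m)) (X 0) (mk_ext m X f) (mk_ext m T t)"
  proof (rule leads_to_mk_ext[OF exact_seq_axioms ex T(1,4) _ \<phi>(1,4)])
    show "\<phi> k \<in> Hom n (X k) (T k)" if "k \<in> {1..m}" for k using that \<phi>_hom by simp
    fix k i x assume k: "k \<le> m" and i: "i \<in> {1..n}" and x: "x \<in> points (vert (X k) i)"
    consider "k = 0" | "1 \<le> k" "k < m" | "k = m" using k by linarith
    then show "\<phi> (Suc k) i (f k i x) = t k i (\<phi> k i x)"
    proof cases
      case 1
      then show ?thesis using \<phi> r[OF i] x t(1) by (simp add: id_mor_apply[OF i])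
    next
      case 2
      have fx: "f k i x \<in> points (vert (X (Suc k)) i)" using HomD(1)[OF hom[OF k] i x] .
      have "t k i (\<phi> k i x) = base (vert (T (Suc k)) i)"
        using t(3)[OF 2] HomD(1)[OF \<phi>_hom[of k] i x] k i by (simp add: zero_mor_def)
      moreover have "\<phi> (Suc k) i (f k i x) = base (vert (T (Suc k)) i)"
      \<comment> \<open>The square ending at position \<open>m\<close> commutes because two
        consecutive maps of the sequence compose to zero.\<close>
      proof (cases "Suc k = m")
        case True
        then have "\<exists>x\<in>points (vert (X k) i). f k i x = f k i x" "k < m" using x by auto
        then have "f (Suc k) i (f k i x) = base (vert (X (Suc (Suc k))) i)"
          using exact[of k i "f k i x"] i fx x by blast
        then show ?thesis using True \<phi>(3) T by simp
      next
        case False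
        then show ?thesis using \<phi>(5)[of "Suc k"] 2 fx i by (simp add: zero_mor_def)
      qed
      ultimately show ?thesis by simp
    next
      case 3
      then show ?thesis
        using \<phi> HomD(1)[OF hom[of m] i] x t(2) by (simp add: id_mor_apply[OF i])
    qed
  qed
  then show ?thesis by (simp add: triv)
qed

text \<open>With nothing generated in \<open>E_m\<close> beyond base points, the generated
  subextension has only the image of L there, and this is killed by the next map. The given
  extension and the trivial one are then joined through this subextension, with one
  \<open>leads_to\<close> step pointing from it to each of them.\<close>

lemma ext_equiv_trivial:
  fixes X :: "nat \<Rightarrow> 'a::infinite rep"
  assumes X: "exact_seq n m X f" and m: "m \<ge> 2"
    and triv: "\<And>i x. exact_seq.gen n m X f 1 i x \<Longrightarrow> x = base (vert (X 1) i)"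
  shows "(mk_ext m X f, trivial_ext n m (X (Suc m)) (X 0)) \<in> ext_equiv n m (X (Suc m)) (X 0)"
proof -
  interpret exact_seq n m X f by (fact X)
  have m1: "1 \<le> m" using m by simp
  obtain X' f' \<phi> where X': "exact_seq n m X' f'" "X' 0 = X 0" "X' (Suc m) = X (Suc m)"
    and \<phi>: "\<And>k. k \<le> Suc m \<Longrightarrow> \<phi> k \<in> Hom n (X' k) (X k)"
      "\<And>k i. \<lbrakk>k \<le> Suc m; i \<in> {1..n}\<rbrakk> \<Longrightarrow> inj_on (\<phi> k i) (points (vert (X' k) i))"
      "\<And>k i. \<lbrakk>k \<le> Suc m; i \<in> {1..n}\<rbrakk> \<Longrightarrow> \<phi> k i ` points (vert (X' k) i) = gensub k i"
      "\<And>k i x. \<lbrakk>k \<le> m; i \<in> {1..n}; x \<in> points (vert (X' k) i)\<rbrakk>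
        \<Longrightarrow> \<phi> (Suc k) i (f' k i x) = f k i (\<phi> k i x)"
    and lt: "leads_to n m (X (Suc m)) (X 0) (mk_ext m X' f') (mk_ext m X f)"
  proof (rule gen_subextension[of "\<lambda>k i x. x", OF m1 inj_on_id2], goal_cases)
    case (1 X' f' \<phi>)
    show ?case by (rule 1(1)[OF 1(2,3,4,6,7,8,9,10)])
  qed
  interpret X': exact_seq n m X' f' by (fact X'(1))
  have "f' 1 i x = base (vert (X' 2) i)" if i: "i \<in> {1..n}" and x: "x \<in> points (vert (X' 1) i)" for i x
  proof -
    have "\<phi> 1 i x \<in> gensub 1 i" using \<phi>(3)[of 1 i] i x m by auto
    then consider "\<phi> 1 i x = base (vert (X 1) i)"
      | z where "z \<in> points (vert (X 0) i)" "\<phi> 1 i x = f 0 i z"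
      using triv m by (auto simp: gensub_def split: if_splits)
    then have "f 1 i (\<phi> 1 i x) = base (vert (X 2) i)"
    proof cases
      case 1
      then show ?thesis using HomD(2)[OF hom[of 1] i] m by (simp add: numeral_2_eq_2)
    next
      case 2
      then show ?thesis
        using exact[of 0 i "f 0 i z"] HomD(1)[OF hom[of 0] i] i m by (auto simp: numeral_2_eq_2)
    qed
    then have "\<phi> 2 i (f' 1 i x) = \<phi> 2 i (base (vert (X' 2) i))"
      using \<phi>(4)[of 1 i x] i x m HomD(2)[OF \<phi>(1)[of 2] i] by (simp add: numeral_2_eq_2)
    moreover have "f' 1 i x \<in> points (vert (X' 2) i)"
      using HomD(1)[OF X'.hom[of 1] i x] m by (simp add: numeral_2_eq_2)
    ultimately show ?thesis
      using \<phi>(2)[of 2 i] m i reps_vert(2)[OF X'.rep[of 2] i] by (auto dest: inj_onD)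
  qed
  then have "leads_to n m (X (Suc m)) (X 0) (mk_ext m X' f') (trivial_ext n m (X (Suc m)) (X 0))"
    using leads_to_trivial[OF X'(1) m] X'(2,3) by simp
  then have 1: "(mk_ext m X' f', trivial_ext n m (X (Suc m)) (X 0)) \<in> ext_equiv n m (X (Suc m)) (X 0)"
    by (rule leads_to_ext_equiv)
  have 2: "(mk_ext m X f, mk_ext m X' f') \<in> ext_equiv n m (X (Suc m)) (X 0)"
    using leads_to_ext_equiv[OF lt] by (rule symD[OF sym_ext_equiv])
  show ?thesis
    using 2 1 by (rule transD[OF trans_ext_equiv])
qed

text \<open>Vertexwise the middle term is L together with one lift for each nonzero element of N, so
  there is an evident bijection between two middle terms. It respects arrows because an arrow of N
  sends a nonzero element to a nonzero one, whose lift is unique; an arrow with a kernel could send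
  a lift into L in different ways.\<close>

lemma exact_seq_one_leads_to:
  assumes X: "exact_seq n 1 X f" and X': "exact_seq n 1 X' f'"
    and ends: "X' 0 = X 0" "X' (Suc 1) = X (Suc 1)"
    and inj: "\<And>i x. \<lbrakk>i \<in> {1..<n}; x \<in> points (vert (X (Suc 1)) (Suc i));
    arr (X (Suc 1)) i x = base (vert (X (Suc 1)) i)\<rbrakk> \<Longrightarrow> x = base (vert (X (Suc 1)) (Suc i))"
  shows "leads_to n 1 (X (Suc 1)) (X 0) (mk_ext 1 X f) (mk_ext 1 X' f')"
proof -
  interpret exact_seq n 1 X f by (fact X)
  interpret X': exact_seq n 1 X' f' by (fact X')
  let ?N = "X (Suc 1)" and ?L = "X 0"
  have f0: "f 0 \<in> Hom n ?L (X 1)" "f' 0 \<in> Hom n ?L (X' 1)"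
    and f1: "f 1 \<in> Hom n (X 1) ?N" "f' 1 \<in> Hom n (X' 1) ?N"
    using hom[of 0] X'.hom[of 0] hom[of 1] X'.hom[of 1] ends by simp_all
  have reps: "?L \<in> reps n" "?N \<in> reps n" "X 1 \<in> reps n" "X' 1 \<in> reps n"
    using rep[of 0] rep[of "Suc 1"] rep[of 1] X'.rep[of 1] by simp_all
  have ker: "f 1 i y = base (vert ?N i) \<longleftrightarrow> (\<exists>z\<in>points (vert ?L i). y = f 0 i z)"
    if "i \<in> {1..n}" "y \<in> points (vert (X 1) i)" for i y
    using exact[of 0 i y] that by simp
  have ker': "f' 1 i y = base (vert ?N i) \<longleftrightarrow> (\<exists>z\<in>points (vert ?L i). y = f' 0 i z)"
    if "i \<in> {1..n}" "y \<in> points (vert (X' 1) i)" for i y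
    using X'.exact[of 0 i y] that ends by simp
  \<comment> \<open>On the kernel \<open>h\<close> goes through L; off the kernel it picks the
    unique element over the same element of N.\<close>
  define h where "h i x = (if f 1 i x = base (vert ?N i)
    then f' 0 i (inv_into (points (vert ?L i)) (f 0 i) x)
    else SOME y. y \<in> points (vert (X' 1) i) \<and> f' 1 i y = f 1 i x)" for i x
  have h0: "h i (f 0 i z) = f' 0 i z" if "i \<in> {1..n}" "z \<in> points (vert ?L i)" for i z
    using ker[OF that(1) HomD(1)[OF f0(1) that]] inj_first[OF that(1)] that(2) by (auto simp: h_def)
  have h1: "h i x \<in> points (vert (X' 1) i)" "f' 1 i (h i x) = f 1 i x"
    if i: "i \<in> {1..n}" and x: "x \<in> points (vert (X 1) i)" for i x
  proof -
    have "h i x \<in> points (vert (X' 1) i) \<and> f' 1 i (h i x) = f 1 i x"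
    proof (cases "f 1 i x = base (vert ?N i)")
      case True
      then obtain z where z: "z \<in> points (vert ?L i)" "x = f 0 i z" using ker[OF i x] by blast
      then show ?thesis
        using True h0[OF i z(1)] HomD(1)[OF f0(2) i z(1)] ker'[OF i HomD(1)[OF f0(2) i z(1)]] by auto
    next
      case False
      have "\<exists>y. y \<in> points (vert (X' 1) i) \<and> f' 1 i y = f 1 i x"
        using X'.epi[OF i, of "f 1 i x"] HomD(1)[OF f1(1) i x] ends by auto
      from someI_ex[OF this] show ?thesis using False by (simp add: h_def)
    qed
    then show "h i x \<in> points (vert (X' 1) i)" "f' 1 i (h i x) = f 1 i x" by auto
  qed
  define r where "r = (\<lambda>i\<in>{1..n}. \<lambda>x\<in>points (vert (X 1) i). h i x)"
  have r: "r i x = h i x" if "i \<in> {1..n}" "x \<in> points (vert (X 1) i)" for i x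
    using that by (simp add: r_def)
  have r_hom: "r \<in> Hom n (X 1) (X' 1)"
    unfolding r_def
  proof (rule restrict_Hom[OF _ _ _ _ reps(3)])
    fix i assume i: "i \<in> {1..n}"
    show "h i (base (vert (X 1) i)) = base (vert (X' 1) i)"
      using h0[OF i reps_vert(2)[OF reps(1) i]] HomD(2)[OF f0(1) i] HomD(2)[OF f0(2) i] by simp
    fix x assume x: "x \<in> points (vert (X 1) i)"
    show "h i x \<in> points (vert (X' 1) i)" by (fact h1(1)[OF i x])
    fix y assume y: "y \<in> points (vert (X 1) i)" and xy: "h i x = h i y"
    then have eq: "f 1 i x = f 1 i y" using h1(2)[OF i x] h1(2)[OF i y] by simp
    show "x = y"
    proof (cases "f 1 i x = base (vert ?N i)")
      case True
      then obtain z w where "z \<in> points (vert ?L i)" "x = f 0 i z"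
          "w \<in> points (vert ?L i)" "y = f 0 i w"
        using ker[OF i x] ker[OF i y] eq by auto
      then show ?thesis
        using xy h0[OF i] X'.inj_first[OF i] ends by (auto dest: inj_onD)
    qed (use HomD(3)[OF f1(1) i x y eq] in blast)
  next
    fix i x assume i: "i \<in> {1..<n}" and x: "x \<in> points (vert (X 1) (Suc i))"
    then have i': "i \<in> {1..n}" "Suc i \<in> {1..n}" by auto
    show "h i (arr (X 1) i x) = arr (X' 1) i (h (Suc i) x)"
    proof (cases "f 1 (Suc i) x = base (vert ?N (Suc i))")
      case True
      then obtain z where z: "z \<in> points (vert ?L (Suc i))" "x = f 0 (Suc i) z"
        using ker[OF i'(2) x] by blast
      then show ?thesis
        using Hom_arr[OF f0(1) i z(1)] Hom_arr[OF f0(2) i z(1)] h0[OF i'(2) z(1)]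
          h0[OF i'(1) reps_arr(1)[OF reps(1) i z(1)]] by simp
    next
      case False
      have ax: "arr (X 1) i x \<in> points (vert (X 1) i)" using reps_arr(1)[OF reps(3) i x] .
      have "f' 1 i (h i (arr (X 1) i x)) = arr ?N i (f 1 (Suc i) x)"
        using h1(2)[OF i'(1) ax] Hom_arr[OF f1(1) i x] by simp
      moreover have "\<dots> = f' 1 i (arr (X' 1) i (h (Suc i) x))"
        using h1(2)[OF i'(2) x] Hom_arr[OF f1(2) i h1(1)[OF i'(2) x]] by simp
      \<comment> \<open>Injectivity of the arrows of N enters here: both candidates lie over the
        same nonzero element and must therefore agree.\<close>
      moreover have "arr ?N i (f 1 (Suc i) x) \<noteq> base (vert ?N i)"
        using inj[OF i HomD(1)[OF f1(1) i'(2) x]] False by blast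
      ultimately show ?thesis
        using HomD(3)[OF f1(2) i'(1) h1(1)[OF i'(1) ax]
          reps_arr(1)[OF reps(4) i h1(1)[OF i'(2) x]]] by simp
    qed
  qed
  show ?thesis
  proof (rule leads_to_mk_ext[OF X X' ends,
      where \<phi> = "\<lambda>k. if k = 0 then id_mor n ?L else if k = 1 then r else id_mor n ?N"])
    fix k i x assume k: "k \<le> (1::nat)" and i: "i \<in> {1..n}" and x: "x \<in> points (vert (X k) i)"
    consider "k = 0" | "k = 1" using k by linarith
    then show "(if Suc k = 0 then id_mor n ?L else if Suc k = 1 then r else id_mor n ?N) i (f k i x) =
      f' k i ((if k = 0 then id_mor n ?L else if k = 1 then r else id_mor n ?N) i x)"
    proof cases
      case 1
      then show ?thesis
        using x h0[OF i] r[OF i HomD(1)[OF f0(1) i]] by (simp add: id_mor_apply[OF i])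
    next
      case 2
      then show ?thesis
        using x h1(2)[OF i] r[OF i] HomD(1)[OF f1(1) i] by (simp add: id_mor_apply[OF i])
    qed
  qed (use r_hom in auto)
qed

section \<open>The Euler form\<close>

lemma f1_space_Ext:
  fixes L N :: "'a::infinite rep"
  assumes L: "L \<in> reps n" and N: "N \<in> reps n"
  shows "f1_space (Ext n m N L)"
proof (cases "m = 0")
  case True
  then show ?thesis
    using finite_Hom[OF N L] zero_mor_Hom[OF N L] by (simp add: Ext_def f1_space_def)
next
  case False
  then show ?thesis
    using finite_Ext_quotient[OF L N, of m] trivial_ext_in_extensions[OF L N, of m]
    by (auto simp: Ext_def f1_space_def quotientI)
qed

lemma pdim_Ext_eq_0:
  fixes L N :: "'a::infinite rep"
  assumes m: "m \<ge> 1"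
    and "\<And>e. e \<in> extensions n m N L \<Longrightarrow> (e, trivial_ext n m N L) \<in> ext_equiv n m N L"
  shows "pdim (Ext n m N L) = 0"
proof -
  have "extensions n m N L // ext_equiv n m N L \<subseteq> {ext_equiv n m N L `` {trivial_ext n m N L}}"
  proof
    fix C assume "C \<in> extensions n m N L // ext_equiv n m N L"
    then obtain e where "e \<in> extensions n m N L" "C = ext_equiv n m N L `` {e}"
      by (rule quotientE)
    then show "C \<in> {ext_equiv n m N L `` {trivial_ext n m N L}}"
      using equiv_class_eq[OF equiv_ext_equiv assms(2)] by blast
  qed
  then have "card (extensions n m N L // ext_equiv n m N L) \<le> 1"
    by (auto dest: card_mono[rotated])
  then show ?thesis using m by (simp add: pdim_def Ext_def card_image)
qed

text \<open>A nonzero generated element of \<open>E_m\<close> at vertex \<open>i\<close> would force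
  \<open>i + (m - 1) \<le> n\<close>, impossible for \<open>i \<ge> 1\<close> and
  \<open>m > n\<close>.\<close>

lemma pdim_Ext_long:
  fixes L N :: "'a::infinite rep"
  assumes L: "L \<in> reps n" and N: "N \<in> reps n" and n: "n \<ge> 1" and m: "m > n"
  shows "pdim (Ext n m N L) = 0"
proof (rule pdim_Ext_eq_0)
  fix e assume "e \<in> extensions n m N L"
  then obtain X f where e: "e = mk_ext m X f" and X: "exact_seq n m X f" "X 0 = L" "X (Suc m) = N"
    using extensionsE L N by blast
  interpret exact_seq n m X f by (fact X(1))
  have "x = base (vert (X 1) i)" if gen: "gen 1 i x" for i x
  proof (rule ccontr)
    assume "x \<noteq> base (vert (X 1) i)"
    then have "i + (m - 1) \<le> n" using gen_height[OF gen] n m by simp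
    moreover have "i \<ge> 1" using gen_points[OF gen] by simp
    ultimately show False using m by simp
  qed
  then show "(e, trivial_ext n m N L) \<in> ext_equiv n m N L"
    using ext_equiv_trivial[OF X(1)] X(2,3) e n m by simp
qed (use n m in simp)

text \<open>Over a field, representations of this quiver with injective arrows are the projective
  ones, so this is the counterpart of the usual vanishing. The case \<open>m = 1\<close> stands
  apart because its trivial extension is the direct sum.\<close>

lemma pdim_Ext_injective:
  fixes L N :: "'a::infinite rep"
  assumes L: "L \<in> reps n" and N: "N \<in> reps n" and m: "m \<ge> 1"
    and inj: "\<And>i x. \<lbrakk>i \<in> {1..<n}; x \<in> points (vert N (Suc i)); arr N i x = base (vert N i)\<rbrakk>
      \<Longrightarrow> x = base (vert N (Suc i))"
  shows "pdim (Ext n m N L) = 0"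
proof (rule pdim_Ext_eq_0[OF m])
  fix e assume "e \<in> extensions n m N L"
  then obtain X f where e: "e = mk_ext m X f" and X: "exact_seq n m X f" "X 0 = L" "X (Suc m) = N"
    using extensionsE L N by blast
  interpret exact_seq n m X f by (fact X(1))
  show "(e, trivial_ext n m N L) \<in> ext_equiv n m N L"
  proof (cases "m = 1")
    case True
    obtain X' f' where t: "trivial_ext n m N L = mk_ext m X' f'"
      and X': "exact_seq n m X' f'" "X' 0 = L" "X' (Suc m) = N"
      using extensionsE[OF trivial_ext_in_extensions[OF L N m] L N] by blast
    have "leads_to n 1 (X (Suc 1)) (X 0) (mk_ext 1 X f) (mk_ext 1 X' f')"
      by (rule exact_seq_one_leads_to) (use X X' True inj in auto)
    then show ?thesis using leads_to_ext_equiv X(2,3) e t True by simp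
  next
    case False
    then have m2: "m \<ge> 2" using m by simp
    have "x = base (vert (X 1) i)" if "gen 1 i x" for i x
      by (rule gen_kernel[OF _ that]) (use inj X(3) m2 in auto)
    then show ?thesis
      using ext_equiv_trivial[OF X(1) m2] X(2,3) e by simp
  qed
qed

text \<open>Only the term of index 0 survives; subtracting one discards the zero morphism.\<close>

lemma euler_form_injective:
  fixes L N :: "'a::infinite rep"
  assumes L: "L \<in> reps n" and N: "N \<in> reps n"
    and inj: "\<And>i x. \<lbrakk>i \<in> {1..<n}; x \<in> points (vert N (Suc i)); arr N i x = base (vert N i)\<rbrakk>
      \<Longrightarrow> x = base (vert N (Suc i))"
  shows "euler_form n N L = int (card (Hom n N L) - 1)"
proof -
  have "euler_term n N L i = 0" if "i \<noteq> 0" for i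
  proof -
    have "1 \<le> i" using that by simp
    then have "pdim (Ext n i N L) = 0" using inj by (rule pdim_Ext_injective[OF L N])
    then show ?thesis by (simp add: euler_term_def)
  qed
  then have "{i. euler_term n N L i \<noteq> 0} \<subseteq> {0}" by auto
  then have "euler_form n N L = sum (euler_term n N L) {0}"
    unfolding euler_form_def by (rule Sum_any.expand_superset[rotated]) simp
  then show ?thesis by (simp add: euler_term_def pdim_def Ext_def card_image)
qed

section \<open>The counterexample on the quiver with two vertices\<close>

definition rep2 :: "'a pointed \<Rightarrow> 'a pointed \<Rightarrow> ('a \<Rightarrow> 'a) \<Rightarrow> 'a rep" where
  "rep2 V1 V2 h = \<lparr>vert = (\<lambda>i\<in>{1..2}. if i = 1 then V1 else V2),
    arr = (\<lambda>i\<in>{1..<2}. \<lambda>x\<in>points V2. h x)\<rparr>"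

lemma rep2_sel [simp]:
  "vert (rep2 V1 V2 h) (Suc 0) = V1" "vert (rep2 V1 V2 h) 2 = V2"
  "vert (rep2 V1 V2 h) (Suc (Suc 0)) = V2"
  "arr (rep2 V1 V2 h) (Suc 0) = (\<lambda>x\<in>points V2. h x)"
  by (auto simp: rep2_def)

lemma atLeastAtMost_1_2: "i \<in> {1..2::nat} \<longleftrightarrow> i = Suc 0 \<or> i = 2" by auto

lemma rep2_reps:
  assumes "f1_space V1" "f1_space V2" "restrict h (points V2) \<in> f1_linear V2 V1"
  shows "rep2 V1 V2 h \<in> reps 2"
proof (rule repsI)
  fix i :: nat assume "i \<in> {1..<2}"
  then have "i = Suc 0" by auto
  then show "arr (rep2 V1 V2 h) i \<in> f1_linear (vert (rep2 V1 V2 h) (Suc i)) (vert (rep2 V1 V2 h) i)"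
    using assms by simp
next
  fix i :: nat assume "i \<in> {1..2}"
  then show "f1_space (vert (rep2 V1 V2 h) i)"
    unfolding atLeastAtMost_1_2 using assms by auto
qed (auto simp: rep2_def)

text \<open>With \<open>P = (1 \<leftarrow> 2)\<close> the projective cover of the simple \<open>S\<^sub>2\<close>, the witnesses are
  \<open>\<langle>P \<oplus> S\<^sub>1, P\<rangle> = 2\<close> and \<open>\<langle>P \<oplus> S\<^sub>1, S\<^sub>1 \<oplus> S\<^sub>2\<rangle> = 3\<close>. A morphism to \<open>P\<close> cannot be nonzero on both
  summands, as both images contain the socle; over a field such a morphism exists.\<close>

lemma euler_form_not_descend:
  obtains L L' N :: "'a::infinite rep" where "L \<in> reps 2" "L' \<in> reps 2" "N \<in> reps 2"
    "dimvec 2 L = dimvec 2 L'" "euler_form 2 N L \<noteq> euler_form 2 N L'"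
proof -
  obtain S :: "'a set" where "finite S" "card S = 3"
    using infinite_arbitrarily_large[OF infinite_UNIV] by blast
  then obtain a b c :: 'a where abc: "a \<noteq> b" "a \<noteq> c" "b \<noteq> c"
    by (auto simp: card_3_iff)
  \<comment> \<open>The point \<open>a\<close> is the base point everywhere. In \<open>N\<close> the
    points called \<open>b\<close> at the two vertices form P, and \<open>c\<close> at vertex 1
    spans the simple summand. With the identity \<open>M\<close> is P, with the constant map it is
    the sum of the two simple representations.\<close>
  define A where "A = \<lparr>points = {a, b}, base = a\<rparr>"
  define B where "B = \<lparr>points = {a, b, c}, base = a\<rparr>"
  define N where "N = rep2 B A (\<lambda>x. x)"
  define M where "M g = rep2 A A g" for g
  have A: "points A = {a, b}" "base A = a" and B: "points B = {a, b, c}" "base B = a"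
    by (simp_all add: A_def B_def)
  have sp: "f1_space A" "f1_space B" by (auto simp: f1_space_def A B)
  have N: "N \<in> reps 2"
    unfolding N_def by (rule rep2_reps[OF sp(2,1)], rule f1_linearI) (auto simp: A B)
  have Mi: "M (\<lambda>x. x) \<in> reps 2"
    unfolding M_def by (rule rep2_reps[OF sp(1,1)], rule f1_linearI) (auto simp: A)
  have Mz: "M (\<lambda>x. a) \<in> reps 2"
    unfolding M_def by (rule rep2_reps[OF sp(1,1)], rule f1_linearI) (auto simp: A)
  \<comment> \<open>A morphism out of \<open>N\<close> is determined by its values on the two
    generators, \<open>b\<close> at vertex 2 and \<open>c\<close> at vertex 1; the value on
    \<open>b\<close> at vertex 1 follows along the arrow.\<close>
  define p where "p \<phi> = (\<phi> 2 b, \<phi> (Suc 0) c)" for \<phi> :: "'a mor"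
  have sN: "vert N (Suc 0) = B" "vert N 2 = A" "vert N (Suc (Suc 0)) = A"
      "arr N (Suc 0) = (\<lambda>x\<in>{a, b}. x)"
    and sM: "vert (M g) (Suc 0) = A" "vert (M g) 2 = A" "vert (M g) (Suc (Suc 0)) = A"
      "arr (M g) (Suc 0) = (\<lambda>x\<in>{a, b}. g x)" for g
    by (simp_all add: N_def M_def A)
  have Hom_vals: "\<phi> 2 a = a" "\<phi> 2 b \<in> {a, b}" "\<phi> (Suc 0) a = a" "\<phi> (Suc 0) b = g (\<phi> 2 b)"
      "\<phi> (Suc 0) c \<in> {a, b}" "\<phi> (Suc 0) b = \<phi> (Suc 0) c \<Longrightarrow> \<phi> (Suc 0) c = a"
    if \<phi>: "\<phi> \<in> Hom 2 N (M g)" for \<phi> g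
  proof -
    have "Suc 0 \<in> {1..2}" "2 \<in> {1..2::nat}" by auto
    note H1 = HomD[OF \<phi> this(1), unfolded sN sM A B] and H2 = HomD[OF \<phi> this(2), unfolded sN sM A B]
    show "\<phi> 2 a = a" "\<phi> (Suc 0) a = a" using H1(2) H2(2) by auto
    show b: "\<phi> 2 b \<in> {a, b}" "\<phi> (Suc 0) c \<in> {a, b}" using H1(1)[of c] H2(1)[of b] by auto
    show "\<phi> (Suc 0) b = g (\<phi> 2 b)"
      using Hom_arr[OF \<phi>, of "Suc 0" b] b by (auto simp: sN sM A numeral_2_eq_2)
    show "\<phi> (Suc 0) c = a" if "\<phi> (Suc 0) b = \<phi> (Suc 0) c"
      using H1(3)[OF _ _ that] that abc(3) by auto
  qed
  have inj_p: "inj_on p (Hom 2 N (M g))" for g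
  proof (rule inj_onI)
    fix \<phi> \<psi> assume \<phi>: "\<phi> \<in> Hom 2 N (M g)" and \<psi>: "\<psi> \<in> Hom 2 N (M g)" and "p \<phi> = p \<psi>"
    then have e: "\<phi> 2 b = \<psi> 2 b" "\<phi> (Suc 0) c = \<psi> (Suc 0) c" by (auto simp: p_def)
    have "\<phi> i x = \<psi> i x" if "i \<in> {1..2}" "x \<in> points (vert N i)" for i x
      using that Hom_vals[OF \<phi>] Hom_vals[OF \<psi>] e
      unfolding atLeastAtMost_1_2 by (auto simp: sN A B)
    moreover have "\<phi> i \<in> extensional (points (vert N i)) \<and> \<psi> i \<in> extensional (points (vert N i))"
      if "i \<in> {1..2}" for i
      using \<phi> \<psi> that unfolding Hom_def f1_linear_def by (auto simp: PiE_def Pi_def)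
    ultimately have "\<phi> i = \<psi> i" if "i \<in> {1..2}" for i
      using that by (meson extensionalityI)
    moreover have "\<phi> \<in> extensional {1..2}" "\<psi> \<in> extensional {1..2}"
      using \<phi> \<psi> unfolding Hom_def by (auto simp: PiE_def)
    ultimately show "\<phi> = \<psi>" by (meson extensionalityI)
  qed
  have le: "card (Hom 2 N (M (\<lambda>x. x))) \<le> 3"
  proof -
    \<comment> \<open>The pair \<open>(b, b)\<close> is impossible: the arrow of the target would
      force \<open>b\<close> and \<open>c\<close> at vertex 1 to have the same nonzero
      image.\<close>
    have "p ` Hom 2 N (M (\<lambda>x. x)) \<subseteq> {(a, a), (a, b), (b, a)}"
      proof
      fix z assume "z \<in> p ` Hom 2 N (M (\<lambda>x. x))"
      then obtain \<phi> where \<phi>: "\<phi> \<in> Hom 2 N (M (\<lambda>x. x))" "z = p \<phi>" by blast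
      show "z \<in> {(a, a), (a, b), (b, a)}"
        using Hom_vals[OF \<phi>(1)] abc \<phi>(2) by (auto simp: p_def)
    qed
    then have "card (Hom 2 N (M (\<lambda>x. x))) \<le> card {(a, a), (a, b), (b, a)}"
      by (intro card_inj_on_le[OF inj_p]) auto
    then show ?thesis using abc by simp
  qed
  have ge: "4 \<le> card (Hom 2 N (M (\<lambda>x. a)))"
  proof -
    have "(x, y) \<in> p ` Hom 2 N (M (\<lambda>x. a))" if xy: "x \<in> {a, b}" "y \<in> {a, b}" for x y
    proof
      \<comment> \<open>The target arrow is zero, so \<open>b\<close> at vertex 1 must go to the
        base point, and the values on the two generators can then be prescribed
        independently.\<close>
      let ?h = "\<lambda>i z. if i = 2 then (if z = b then x else a) else (if z = c then y else a)"
      let ?\<phi> = "\<lambda>i\<in>{1..2}. \<lambda>z\<in>points (vert N i). ?h i z"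
      show "(x, y) = p ?\<phi>" by (simp add: p_def sN A B)
      show "?\<phi> \<in> Hom 2 N (M (\<lambda>x. a))"
      proof (rule restrict_Hom[OF _ _ _ _ N])
        fix i z assume "i \<in> {1..<2::nat}" "z \<in> points (vert N (Suc i))"
        then have "i = Suc 0" "z \<in> {a, b}" by (auto simp: numeral_2_eq_2 less_Suc_eq sN A)
        then show "?h i (arr N i z) = arr (M (\<lambda>x. a)) i (?h (Suc i) z)"
          using xy abc by (auto simp: sN sM)
      qed (unfold atLeastAtMost_1_2, use xy abc in \<open>auto simp: sN sM A B split: if_splits\<close>)
    qed
    then have "{a, b} \<times> {a, b} \<subseteq> p ` Hom 2 N (M (\<lambda>x. a))" by auto
    then have "card ({a, b} \<times> {a, b}) \<le> card (Hom 2 N (M (\<lambda>x. a)))"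
      using finite_Hom[OF N Mz] by (meson card_image_le card_mono finite_imageI order_trans)
    then show ?thesis using abc by simp
  qed
  have arr_inj: "x = base (vert N (Suc i))"
    if "i \<in> {1..<2}" "x \<in> points (vert N (Suc i))" "arr N i x = base (vert N i)" for i x
  proof -
    have "i = Suc 0" using that(1) by auto
    then show ?thesis using that(2,3) by (auto simp: sN A B)
  qed
  have "euler_form 2 N (M (\<lambda>x. x)) \<noteq> euler_form 2 N (M (\<lambda>x. a))"
  proof -
    have "euler_form 2 N (M g) = int (card (Hom 2 N (M g)) - 1)" if "M g \<in> reps 2" for g
      using that N arr_inj by (rule euler_form_injective)
    from this[OF Mi] this[OF Mz] show ?thesis using le ge by simp
  qed
  moreover have "dimvec 2 (M (\<lambda>x. x)) = dimvec 2 (M (\<lambda>x. a))"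
    by (simp add: dimvec_def M_def rep2_def cong: restrict_cong)
  ultimately show thesis using that Mi Mz N by blast
qed

theorem mainTheorem2:
  shows "(\<forall>n\<ge>1. \<forall>L\<in>(reps n :: 'a::infinite rep set). \<forall>N\<in>(reps n :: 'a rep set).
            (\<forall>i. f1_space (Ext n i L N)) \<and> finite {i. euler_term n L N i \<noteq> 0})
       \<and> (\<exists>L\<in>(reps 2 :: 'a rep set). \<exists>L'\<in>(reps 2 :: 'a rep set).
          \<exists>N\<in>(reps 2 :: 'a rep set). \<exists>N'\<in>(reps 2 :: 'a rep set).
            dimvec 2 L = dimvec 2 L' \<and> dimvec 2 N = dimvec 2 N' \<and>
            euler_form 2 L N \<noteq> euler_form 2 L' N')"
proof (intro conjI allI impI ballI)
  fix n :: nat and L N :: "'a rep" assume n: "n \<ge> 1" and L: "L \<in> reps n" and N: "N \<in> reps n"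
  \<comment> \<open>The roles of the letters are exchanged: the lemmas above call the left end L and
    the right end N, while here L is the first argument of Ext.\<close>
  show "f1_space (Ext n i L N)" for i by (rule f1_space_Ext[OF N L])
  have "euler_term n L N i = 0" if "n < i" for i
    using pdim_Ext_long[OF N L n that] by (simp add: euler_term_def)
  then have "{i. euler_term n L N i \<noteq> 0} \<subseteq> {..n}"
    by (auto intro: leI)
  then show "finite {i. euler_term n L N i \<noteq> 0}" by (rule finite_subset) simp
next
  obtain L L' N :: "'a rep" where "L \<in> reps 2" "L' \<in> reps 2" "N \<in> reps 2"
    "dimvec 2 L = dimvec 2 L'" "euler_form 2 N L \<noteq> euler_form 2 N L'"
    by (rule euler_form_not_descend)
  then show "\<exists>L\<in>(reps 2 :: 'a rep set). \<exists>L'\<in>(reps 2 :: 'a rep set).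
      \<exists>N\<in>(reps 2 :: 'a rep set). \<exists>N'\<in>(reps 2 :: 'a rep set).
        dimvec 2 L = dimvec 2 L' \<and> dimvec 2 N = dimvec 2 N' \<and>
        euler_form 2 L N \<noteq> euler_form 2 L' N'"
    \<comment> \<open>Both pairs share their first argument, so the form already fails to descend in
      the second argument alone.\<close>
    by (intro bexI[of _ N] bexI[of _ N] bexI[of _ L] bexI[of _ L']) auto
qed

end
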